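(* Let $N\ge 1$, $s\in(0,1)$, and let $f:(0,\infty)\times\mathbb{R}^N\times\mathbb{R}\to\mathbb{R}$ be a Carathéodory function with $f(t,x,r)r\ge 0$ for all $(t,x,r)$. Let $u$ be a nonnegative classical solution of $$\partial_t u+(-\Delta)^s u+f(t,x,u)=0\quad\text{in } Q_\infty=(0,\infty)\times\mathbb{R}^N.$$ If $u\in L^1(0,T;\mathcal L^s(\mathbb{R}^N))$ for some $T>0$, then $\mathcal S_u=\tilde{\mathcal S}_u$, and more precisely, for any $z\in\mathcal S_u$, $$\lim_{t\to 0}\int_{B_\rho(z)}u(t,x)\,dx=+\infty\qquad\text{for any }\rho>0.$$
   Context: The fractional Laplacian is $(-\Delta)^s\phi(x)=\lim_{\varepsilon\to0^+}a_{N,s}\int_{|z-x|>\varepsilon}\frac{\phi(x)-\phi(z)}{|z-x|^{N+2s}}dz$, with $a_{N,s}=\frac{\Gamma(\frac N2+s)}{\pi^{N/2}\Gamma(2-s)}s(1-s)$. $\mathcal L^s(\mathbb{R}^N)$ is the space of $\phi\in L^1_{loc}(\mathbb{R}^N)$ with $\|\phi\|_{\mathcal L^s}=\int_{\mathbb{R}^N}\frac{|\phi(x)|}{1+|x|^{N+2s}}dx<+\infty$. Solutions are understood in the classical (pointwise) sense, and it is always assumed that $u(t,\cdot)\in\mathcal L^s(\mathbb{R}^N)$ for every $t>0$. $B_\rho(z)$ is the open ball of center $z$ and radius $\rho$. The conditional singular set is $\tilde{\mathcal S}_u=\mathbb{R}^N\setminus\mathcal R_u$, where $\mathcal R_u=\{z\in\mathbb{R}^N:\exists\rho>0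 \text{ s.t. } \int_0^1\int_{B_\rho(z)}f(t,x,u)\,dx\,dt<+\infty\}$. The singular set is $\mathcal S_u=\{z\in\mathbb{R}^N:\limsup_{t\to0}\int_{B_\rho(z)}u(t,x)\,dx=+\infty\text{ for any }\rho>0\}$. *)

theory Defs
  imports "HOL-Analysis.Analysis"
begin

definition halfspace :: "(real \<times> (real^'n)) set" where
  "halfspace = {0<..} \<times> UNIV"

definition frac_const :: "'n::finite itself \<Rightarrow> real \<Rightarrow> real" where
  "frac_const _ s =
     Gamma (real CARD('n) / 2 + s) / (pi powr (real CARD('n) / 2) * Gamma (2 - s)) * s * (1 - s)"

text \<open>The fractional Laplacian of \<open>\<phi>\<close> of order \<open>s\<close> exists at \<open>x\<close> and equals \<open>L\<close>.
  For \<open>\<phi>\<close> in the weighted space \<open>in_Ls s\<close> below, the integrand is integrable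
  for each \<open>\<epsilon> > 0\<close>, so the value \<open>0\<close> of non-convergent integrals plays no role.\<close>

definition has_frac_laplacian ::
    "real \<Rightarrow> (real^'n \<Rightarrow> real) \<Rightarrow> real^'n \<Rightarrow> real \<Rightarrow> bool" where
  "has_frac_laplacian s \<phi> x L \<longleftrightarrow>
     ((\<lambda>\<epsilon>. frac_const TYPE('n) s *
            (LINT z:{z. norm (z - x) > \<epsilon>}|lebesgue.
               (\<phi> x - \<phi> z) / norm (z - x) powr (real CARD('n) + 2 * s)))
        \<longlongrightarrow> L) (at_right 0)"

definition Ls_norm :: "real \<Rightarrow> (real^'n \<Rightarrow> real) \<Rightarrow> ennreal" where
  "Ls_norm s \<phi> =
     (\<integral>\<^sup>+ x. ennreal (\<bar>\<phi> x\<bar> / (1 + norm x powr (real CARD('n) + 2 * s))) \<partial>lebesgue)"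

definition in_Ls :: "real \<Rightarrow> (real^'n \<Rightarrow> real) \<Rightarrow> bool" where
  "in_Ls s \<phi> \<longleftrightarrow> (\<forall>K. compact K \<longrightarrow> set_integrable lebesgue K \<phi>) \<and> Ls_norm s \<phi> < \<infinity>"

text \<open>Membership in \<open>L\<^sup>1(0,T; \<L>\<^sup>s)\<close>. The target is a weighted \<open>L\<^sup>1\<close> space, so strong
  measurability in time amounts to joint measurability.\<close>

definition in_L1_Ls :: "real \<Rightarrow> real \<Rightarrow> (real \<Rightarrow> real^'n \<Rightarrow> real) \<Rightarrow> bool" where
  "in_L1_Ls s T u \<longleftrightarrow>
     (\<lambda>(t, x). u t x) \<in> borel_measurable (lebesgue_on ({0<..<T} \<times> UNIV)) \<and>
     (AE t in lebesgue_on {0<..<T}. in_Ls s (u t)) \<and>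
     (\<integral>\<^sup>+ t\<in>{0<..<T}. Ls_norm s (u t) \<partial>lebesgue) < \<infinity>"

definition caratheodory :: "(real \<Rightarrow> real^'n \<Rightarrow> real \<Rightarrow> real) \<Rightarrow> bool" where
  "caratheodory f \<longleftrightarrow>
     (\<forall>r. (\<lambda>(t, x). f t x r) \<in> borel_measurable (lebesgue_on halfspace)) \<and>
     (AE (t, x) in lebesgue_on halfspace. continuous_on UNIV (f t x))"

text \<open>Classical solutions of \<open>\<partial>\<^sub>t u + (-\<Delta>)\<^sup>s u + f(t,x,u) = 0\<close>: as usual for classical solutions,
  \<open>u\<close> and the two terms \<open>\<partial>\<^sub>t u\<close>, \<open>(-\<Delta>)\<^sup>s u\<close> are continuous on \<open>(0,\<infinity>) \<times> \<real>\<^sup>N\<close>. No continuity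
  at \<open>t = 0\<close> is required, and the values of \<open>u\<close> and \<open>f\<close> for \<open>t \<le> 0\<close> are irrelevant.\<close>

definition classical_solution ::
    "real \<Rightarrow> (real \<Rightarrow> real^'n \<Rightarrow> real \<Rightarrow> real) \<Rightarrow> (real \<Rightarrow> real^'n \<Rightarrow> real) \<Rightarrow> bool" where
  "classical_solution s f u \<longleftrightarrow>
     (\<forall>t>0. in_Ls s (u t)) \<and>
     continuous_on halfspace (\<lambda>(t, x). u t x) \<and>
     (\<exists>u\<^sub>t \<Lambda>u.
        continuous_on halfspace (\<lambda>(t, x). u\<^sub>t t x) \<and>
        continuous_on halfspace (\<lambda>(t, x). \<Lambda>u t x) \<and>
        (\<forall>t>0. \<forall>x.
           ((\<lambda>\<tau>. u \<tau> x) has_real_derivative u\<^sub>t t x) (at t) \<and>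
           has_frac_laplacian s (u t) x (\<Lambda>u t x) \<and>
           u\<^sub>t t x + \<Lambda>u t x + f t x (u t x) = 0))"

text \<open>\<open>ennreal\<close> truncates negative values, but for a nonnegative solution and \<open>f t x r * r \<ge> 0\<close>
  the integrand is nonnegative: where \<open>u t x = 0\<close>, a minimum of \<open>u\<close>, one has
  \<open>\<partial>\<^sub>t u = 0\<close> and \<open>(-\<Delta>)\<^sup>s u \<le> 0\<close>, and the equation gives \<open>f t x 0 \<ge> 0\<close>.\<close>

definition regular_set ::
    "(real \<Rightarrow> real^'n \<Rightarrow> real \<Rightarrow> real) \<Rightarrow> (real \<Rightarrow> real^'n \<Rightarrow> real) \<Rightarrow> (real^'n) set" where
  "regular_set f u =
     {z. \<exists>\<rho>>0. (\<integral>\<^sup>+ t\<in>{0<..<1}. (\<integral>\<^sup>+ x\<in>ball z \<rho>. ennreal (f t x (u t x)) \<partial>lebesgue) \<partial>lebesgue) < \<infinity>}"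

definition cond_singular_set ::
    "(real \<Rightarrow> real^'n \<Rightarrow> real \<Rightarrow> real) \<Rightarrow> (real \<Rightarrow> real^'n \<Rightarrow> real) \<Rightarrow> (real^'n) set" where
  "cond_singular_set f u = UNIV - regular_set f u"

definition singular_set :: "(real \<Rightarrow> real^'n \<Rightarrow> real) \<Rightarrow> (real^'n) set" where
  "singular_set u =
     {z. \<forall>\<rho>>0. Limsup (at_right 0) (\<lambda>t. ereal (LINT x:ball z \<rho>|lebesgue. u t x)) = \<infinity>}"

end

theory Submission
  imports Defs
begin

text \<open>Test the equation with a cutoff \<open>\<psi>\<close>, equal to \<open>bump z \<rho>\<close> below. Its mass
  \<open>X(t) = \<integral> u(t,x) \<psi>(x) dx\<close> satisfies \<open>X' = - A - G\<close> with \<open>A(t) = \<integral> ((-\<Delta>)\<^sup>s u) \<psi>\<close> and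
  \<open>G(t) = \<integral> f(t,x,u) \<psi> \<ge> 0\<close>. Since \<open>\<psi>\<close> is \<open>C\<^sup>1\<^sup>,\<^sup>1\<close> with compact support, its truncated
  fractional Laplacians are dominated by \<open>1 / (1 + |x|\<^sup>N\<^sup>+\<^sup>2\<^sup>s)\<close>, whence \<open>|A(t)| \<le> K \<parallel>u(t)\<parallel>\<close> in
  the weighted norm and \<open>A\<close> is integrable near \<open>t = 0\<close>. So \<open>X(t)\<close> equals the integral of \<open>G\<close> from
  \<open>t\<close> to a fixed time up to a bounded error: it stays bounded at a regular point and tends to
  infinity at every other point.

  The delicate step is the estimate of \<open>A\<close>, because the principal value defining \<open>(-\<Delta>)\<^sup>s u\<close> is
  only assumed to converge pointwise.\<close>

section \<open>Truncated fractional Laplacians of solutions\<close>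

text \<open>The Laplacian of the cutoff is never formed. For fixed \<epsilon> > 0 the truncated
  kernel is integrable, so Fubini moves the truncation from the solution to the cutoff, where it is
  bounded uniformly in \<epsilon> because second differences of the cutoff are quadratic and 2s < 2.
  The obstacle is the limit \<epsilon> to 0 on the side of the solution, where no majorant is
  available. A lower bound for the limit, applied to a function and to its negative, is enough, and
  it requires a majorant from above only. A bound 2V(x) - V(x+z) - V(x-z) \<le> B min(1,|z|^2)
  provides one; B blows up as V approaches the original function, so \<epsilon> tends to 0 first,
  with V fixed. The regularisation producing V is run on a bounded, uniformly continuous function,
  which is why the solution is first split by a second cutoff. The final bound has to be linear in
  the weighted norm with a constant that depends on the ball alone: only then can it be integrated
  in time down to t = 0. The spatial lemmas use an exponent p with N < p < N + 2, later p = N + 2s;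
  \<open>decay p\<close> is then the weight of the space.\<close>

definition decay :: "real \<Rightarrow> 'a::real_normed_vector \<Rightarrow> real" where
  "decay p x = 1 / (1 + norm x powr p)"

definition trunc_kernel :: "real \<Rightarrow> real \<Rightarrow> 'a::real_normed_vector \<Rightarrow> real" where
  "trunc_kernel p \<epsilon> z = (if \<epsilon> < norm z then 1 / norm z powr p else 0)"

text \<open>The kernel frozen inside the ball of radius \<epsilon> at its value on the sphere. It
  agrees with \<open>trunc_kernel\<close> outside that ball, dominates it everywhere, and is
  continuous, whereas \<open>trunc_kernel\<close> jumps.\<close>

definition reg_kernel :: "real \<Rightarrow> real \<Rightarrow> 'a::real_normed_vector \<Rightarrow> real" where
  "reg_kernel p \<epsilon> z = 1 / (max \<epsilon> (norm z)) powr p"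

text \<open>The normalising constant is left out, and the integration variable is the displacement
  z, so that the reflection of z can be used to symmetrise.\<close>

definition trunc_lap :: "real \<Rightarrow> real \<Rightarrow> ('a::euclidean_space \<Rightarrow> real) \<Rightarrow> 'a \<Rightarrow> real" where
  "trunc_lap p \<epsilon> \<phi> x = (\<integral>z. trunc_kernel p \<epsilon> z * (\<phi> x - \<phi> (x + z)) \<partial>lborel)"

lemma decay_pos: "0 < decay p x"
  unfolding decay_def by (simp add: add_pos_nonneg)

lemma decay_le_1: "decay p x \<le> 1"
  unfolding decay_def by (simp add: divide_le_eq_1 add_pos_nonneg)

lemma decay_measurable [measurable]: "decay p \<in> borel_measurable borel"
  unfolding decay_def by measurable

lemma trunc_kernel_measurable [measurable]: "trunc_kernel p \<epsilon> \<in> borel_measurable borel"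
  unfolding trunc_kernel_def by measurable

lemma trunc_kernel_nonneg: "0 \<le> trunc_kernel p \<epsilon> z"
  unfolding trunc_kernel_def by simp

lemma reg_kernel_measurable [measurable]: "reg_kernel p \<epsilon> \<in> borel_measurable borel"
  unfolding reg_kernel_def by measurable

lemma reg_kernel_nonneg: "0 \<le> reg_kernel p \<epsilon> z"
  unfolding reg_kernel_def by simp

lemma trunc_kernel_minus: "trunc_kernel p \<epsilon> (- z) = trunc_kernel p \<epsilon> z"
  unfolding trunc_kernel_def by simp

lemma trunc_kernel_commute: "trunc_kernel p \<epsilon> (x - z) = trunc_kernel p \<epsilon> (z - x)"
  unfolding trunc_kernel_def by (simp add: norm_minus_commute)

lemma trunc_kernel_le_reg_kernel: "trunc_kernel p \<epsilon> z \<le> reg_kernel p \<epsilon> z"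
  by (auto simp: trunc_kernel_def reg_kernel_def max_def)

lemma trunc_lap_minus:
  "trunc_lap p \<epsilon> (\<lambda>x. - \<phi> x) x = - trunc_lap p \<epsilon> \<phi> x"
proof -
  have "(\<lambda>z. trunc_kernel p \<epsilon> z * (- \<phi> x - - \<phi> (x + z))) = (\<lambda>z. - (trunc_kernel p \<epsilon> z * (\<phi> x - \<phi> (x + z))))"
    by (auto simp: algebra_simps)
  then show ?thesis unfolding trunc_lap_def by simp
qed

section \<open>Translation invariance and reduction of the fractional Laplacian to
  truncations\<close>

lemma integrable_translate:
  fixes f :: "'a::euclidean_space \<Rightarrow> real"
  shows "integrable lborel (\<lambda>z. f (x + z)) \<longleftrightarrow> integrable lborel f"
proof
  assume "integrable lborel f"
  then have "integrable (distr lborel borel ((+) x)) f" by (simp add: lborel_distr_plus)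
  then show "integrable lborel (\<lambda>z. f (x + z))" by (rule integrable_distr[rotated]) simp
next
  assume "integrable lborel (\<lambda>z. f (x + z))"
  then have "integrable (distr lborel borel ((+) (- x))) (\<lambda>z. f (x + z))" by (simp add: lborel_distr_plus)
  then have "integrable lborel (\<lambda>z. f (x + (- x + z)))" by (rule integrable_distr[rotated]) simp
  then show "integrable lborel f" by simp
qed

lemma integral_translate:
  fixes f :: "'a::euclidean_space \<Rightarrow> real"
  assumes [measurable]: "f \<in> borel_measurable borel"
  shows "(\<integral>z. f (x + z) \<partial>lborel) = (\<integral>z. f z \<partial>lborel)"
  using integral_distr[of "(+) x" lborel borel f] by (simp add: lborel_distr_plus)

lemma trunc_lap_translated:
  fixes \<phi> :: "'a::euclidean_space \<Rightarrow> real"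
  assumes [measurable]: "\<phi> \<in> borel_measurable borel"
  shows "trunc_lap p \<epsilon> \<phi> x = (\<integral>z. trunc_kernel p \<epsilon> (z - x) * (\<phi> x - \<phi> z) \<partial>lborel)"
  unfolding trunc_lap_def
  using integral_translate[of "\<lambda>z. trunc_kernel p \<epsilon> (z - x) * (\<phi> x - \<phi> z)" x] by simp

lemma integrable_abs_times_decay:
  assumes "integrable M (\<lambda>x. \<phi> x * decay p x)"
  shows "integrable M (\<lambda>x. \<bar>\<phi> x\<bar> * decay p x)"
  using integrable_abs[OF assms] by (simp add: abs_mult decay_pos less_imp_le)

lemma frac_const_pos:
  assumes "0 < s" "s < 1"
  shows "0 < frac_const TYPE('n::finite) s"
proof -
  have "0 < Gamma (real CARD('n) / 2 + s)" "0 < Gamma (2 - s)"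
    using assms by (intro Gamma_real_pos; simp add: add_nonneg_pos)+
  then show ?thesis using assms unfolding frac_const_def by simp
qed

lemma has_frac_laplacian_iff_trunc_lap:
  fixes \<phi> :: "real^'n \<Rightarrow> real"
  assumes [measurable]: "\<phi> \<in> borel_measurable borel"
  shows "has_frac_laplacian s \<phi> x L \<longleftrightarrow>
    ((\<lambda>\<epsilon>. frac_const TYPE('n) s * trunc_lap (real CARD('n) + 2 * s) \<epsilon> \<phi> x) \<longlongrightarrow> L) (at_right 0)"
proof -
  let ?p = "real CARD('n) + 2 * s"
  have "(LINT z:{z. \<epsilon> < norm (z - x)}|lebesgue. (\<phi> x - \<phi> z) / norm (z - x) powr ?p) = trunc_lap ?p \<epsilon> \<phi> x" for \<epsilon>
  proof -
    have "(LINT z:{z. \<epsilon> < norm (z - x)}|lebesgue. (\<phi> x - \<phi> z) / norm (z - x) powr ?p)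
      = (\<integral>z. trunc_kernel ?p \<epsilon> (z - x) * (\<phi> x - \<phi> z) \<partial>lebesgue)"
      unfolding set_lebesgue_integral_def trunc_kernel_def
      by (intro Bochner_Integration.integral_cong) auto
    also have "\<dots> = (\<integral>z. trunc_kernel ?p \<epsilon> (z - x) * (\<phi> x - \<phi> z) \<partial>lborel)"
      by (rule integral_completion) measurable
    finally show ?thesis by (simp add: trunc_lap_translated)
  qed
  then show ?thesis unfolding has_frac_laplacian_def by simp
qed

lemma Ls_norm_lborel:
  fixes \<phi> :: "real^'n \<Rightarrow> real"
  shows "Ls_norm s \<phi> = (\<integral>\<^sup>+ x. ennreal (\<bar>\<phi> x\<bar> * decay (real CARD('n) + 2 * s) x) \<partial>lborel)"
  unfolding Ls_norm_def decay_def nn_integral_completion by simp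

lemma in_Ls_integrable:
  fixes \<phi> :: "real^'n \<Rightarrow> real"
  assumes [measurable]: "\<phi> \<in> borel_measurable borel" and "in_Ls s \<phi>"
  shows "integrable lborel (\<lambda>x. \<phi> x * decay (real CARD('n) + 2 * s) x)"
    and "Ls_norm s \<phi> = ennreal (\<integral>x. \<bar>\<phi> x\<bar> * decay (real CARD('n) + 2 * s) x \<partial>lborel)"
proof -
  let ?p = "real CARD('n) + 2 * s"
  show i: "integrable lborel (\<lambda>x. \<phi> x * decay ?p x)"
    unfolding integrable_iff_bounded
    using assms unfolding in_Ls_def Ls_norm_lborel
    by (simp add: abs_mult decay_pos less_imp_le)
  show "Ls_norm s \<phi> = ennreal (\<integral>x. \<bar>\<phi> x\<bar> * decay ?p x \<partial>lborel)"
    unfolding Ls_norm_lborel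
    by (intro nn_integral_eq_integral integrable_abs_times_decay i AE_I2)
       (simp add: decay_pos less_imp_le)
qed

section \<open>Regularity and sign of the reaction term\<close>

lemma continuous_on_halfspace_slice:
  assumes "continuous_on halfspace (\<lambda>(t, x). F t x)" "0 < t"
  shows "continuous_on UNIV (F t)"
proof -
  have "continuous_on UNIV ((\<lambda>(t, x). F t x) \<circ> (\<lambda>x. (t, x)))"
    using assms(2)
    by (intro continuous_on_compose continuous_intros continuous_on_subset[OF assms(1)])
       (auto simp: halfspace_def)
  then show ?thesis by (simp add: o_def)
qed

text \<open>Solving the equation for the reaction exhibits it as a combination of the continuous
  terms \<open>ut\<close> and \<open>\<Lambda>\<close>. The sign hypothesis on \<open>f\<close>
  settles the second claim only where u > 0; a zero of u is a minimum in time and in space, and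
  there the equation settles it.\<close>

lemma classical_solution_reaction:
  fixes u :: "real \<Rightarrow> real^'n \<Rightarrow> real"
  assumes s: "0 < s" "s < 1"
    and f_sign: "\<And>t x r. t > 0 \<Longrightarrow> f t x r * r \<ge> 0"
    and sol: "classical_solution s f u"
    and u_nonneg: "\<And>t x. t > 0 \<Longrightarrow> u t x \<ge> 0"
  shows "continuous_on halfspace (\<lambda>(t, x). f t x (u t x))"
    and "0 < t \<Longrightarrow> 0 \<le> f t x (u t x)"
proof -
  obtain ut \<Lambda> where
    ut: "continuous_on halfspace (\<lambda>(t, x). ut t x)" and \<Lambda>: "continuous_on halfspace (\<lambda>(t, x). \<Lambda> t x)"
    and eq: "\<And>t x. 0 < t \<Longrightarrow> ((\<lambda>\<tau>. u \<tau> x) has_real_derivative ut t x) (at t)"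
      "\<And>t x. 0 < t \<Longrightarrow> has_frac_laplacian s (u t) x (\<Lambda> t x)"
      "\<And>t x. 0 < t \<Longrightarrow> ut t x + \<Lambda> t x + f t x (u t x) = 0"
    using sol unfolding classical_solution_def by blast
  have u_cont: "continuous_on halfspace (\<lambda>(t, x). u t x)"
    using sol unfolding classical_solution_def by blast
  have f_eq: "f t x (u t x) = - ut t x - \<Lambda> t x" if "0 < t" for t x
    using eq(3)[OF that, of x] by linarith
  have "continuous_on halfspace (\<lambda>z. - (case z of (t, x) \<Rightarrow> ut t x) - (case z of (t, x) \<Rightarrow> \<Lambda> t x))"
    by (intro continuous_intros ut \<Lambda>)
  then show "continuous_on halfspace (\<lambda>(t, x). f t x (u t x))"
    by (rule continuous_on_eq) (auto simp: halfspace_def f_eq)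
  show "0 \<le> f t x (u t x)" if t: "0 < t" for t x
  proof (cases "u t x = 0")
    case True
    \<comment> \<open>The radius t keeps the comparison interval inside positive times, where u is
      known to be nonnegative.\<close>
    have "ut t x = 0"
      by (rule DERIV_local_min[OF eq(1)[OF t] t]) (use True u_nonneg in auto)
    moreover have "\<Lambda> t x \<le> 0"
    proof (rule tendsto_upperbound)
      have [measurable]: "u t \<in> borel_measurable borel"
        by (rule borel_measurable_continuous_onI[OF continuous_on_halfspace_slice[OF u_cont t]])
      show "((\<lambda>\<epsilon>. frac_const TYPE('n) s * trunc_lap (real CARD('n) + 2 * s) \<epsilon> (u t) x) \<longlongrightarrow> \<Lambda> t x) (at_right 0)"
        using eq(2)[OF t, of x] by (simp add: has_frac_laplacian_iff_trunc_lap)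
      have "0 \<le> (\<integral>z. trunc_kernel (real CARD('n) + 2 * s) \<epsilon> z * u t (x + z) \<partial>lborel)" for \<epsilon>
        by (intro integral_nonneg_AE AE_I2 mult_nonneg_nonneg trunc_kernel_nonneg u_nonneg t)
      then have "trunc_lap (real CARD('n) + 2 * s) \<epsilon> (u t) x \<le> 0" for \<epsilon>
        unfolding trunc_lap_def True by simp
      then show "\<forall>\<^sub>F \<epsilon> in at_right 0. frac_const TYPE('n) s * trunc_lap (real CARD('n) + 2 * s) \<epsilon> (u t) x \<le> 0"
        using frac_const_pos[OF s, where 'n = 'n] by (intro always_eventually allI mult_nonneg_nonpos) auto
    qed simp
    ultimately show ?thesis using f_eq[OF t, of x] by linarith
  next
    case False
    then have "0 < u t x" using u_nonneg[OF t, of x] by simp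
    then show ?thesis using f_sign[OF t, of x "u t x"] by (simp add: zero_le_mult_iff)
  qed
qed

section \<open>The cutoff function and masses on balls\<close>

text \<open>A truncated paraboloid would have a kink on the sphere of radius \<rho>; the outer
  square removes it and leaves a function with Lipschitz gradient, just enough for second
  differences of size |h|^2.\<close>

definition bump :: "'a::real_normed_vector \<Rightarrow> real \<Rightarrow> 'a \<Rightarrow> real" where
  "bump a \<rho> x = (max 0 (1 - (norm (x - a))\<^sup>2 / \<rho>\<^sup>2))\<^sup>2"

lemma bump_nonneg: "0 \<le> bump a \<rho> x"
  unfolding bump_def by simp

lemma bump_le_1: "bump a \<rho> x \<le> 1"
  unfolding bump_def by (intro power_le_one) auto

lemma continuous_on_bump: "continuous_on S (bump a \<rho>)"
  unfolding bump_def divide_inverse by (intro continuous_intros)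

lemma bump_measurable [measurable]: "bump (a::'a::euclidean_space) \<rho> \<in> borel_measurable borel"
  by (intro borel_measurable_continuous_onI continuous_on_bump)

lemma bump_eq_0:
  assumes "0 < \<rho>" "\<rho> \<le> norm (x - a)"
  shows "bump a \<rho> x = 0"
proof -
  have "\<rho>\<^sup>2 \<le> (norm (x - a))\<^sup>2" using assms by (intro power_mono) auto
  then have "1 \<le> (norm (x - a))\<^sup>2 / \<rho>\<^sup>2" using assms by simp
  then show ?thesis unfolding bump_def by simp
qed

lemma bump_ge_half:
  assumes "norm (x - a) < \<rho> / 2"
  shows "1 / 2 \<le> bump a \<rho> x"
proof -
  have \<rho>: "0 < \<rho>" using assms norm_ge_zero[of "x - a"] by linarith
  have "(norm (x - a))\<^sup>2 \<le> (\<rho> / 2)\<^sup>2" using assms by (intro power_mono) auto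
  then have "(norm (x - a))\<^sup>2 / \<rho>\<^sup>2 \<le> 1 / 4" using \<rho> by (simp add: field_simps)
  then have "3 / 4 \<le> max 0 (1 - (norm (x - a))\<^sup>2 / \<rho>\<^sup>2)" by linarith
  \<comment> \<open>The value 9/16 exceeds 1/2.\<close>
  then have "(3 / 4)\<^sup>2 \<le> bump a \<rho> x" unfolding bump_def by (rule power_mono) simp
  then show ?thesis by (simp add: power2_eq_square)
qed

section \<open>Integrals against the cutoff and masses on balls\<close>

lemma integrable_bump_times_continuous:
  fixes h :: "'a::euclidean_space \<Rightarrow> real"
  assumes "0 < \<rho>" "continuous_on UNIV h"
  shows "integrable lborel (\<lambda>x. bump a \<rho> x * h x)"
proof -
  have "integrable lborel (\<lambda>x. indicator (cball a \<rho>) x *\<^sub>R (bump a \<rho> x * h x))"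
    by (intro borel_integrable_compact continuous_intros continuous_on_bump continuous_on_subset[OF assms(2)]) auto
  moreover have "indicator (cball a \<rho>) x *\<^sub>R (bump a \<rho> x * h x) = bump a \<rho> x * h x" for x
    using bump_eq_0[OF assms(1), of x a] by (auto simp: indicator_def dist_norm norm_minus_commute)
  ultimately show ?thesis by (simp only:)
qed

lemma integrable_continuous_on_bounded_set:
  fixes \<phi> :: "'a::euclidean_space \<Rightarrow> real"
  assumes "continuous_on UNIV \<phi>"
  shows "integrable lborel (\<lambda>x. indicator (ball a \<rho>) x * \<phi> x)"
proof -
  have "set_integrable lborel (cball a \<rho>) \<phi>"
    unfolding set_integrable_def
    by (rule borel_integrable_compact) (auto intro: continuous_on_subset[OF assms])
  then have "set_integrable lborel (ball a \<rho>) \<phi>"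
    by (rule set_integrable_subset) auto
  then show ?thesis unfolding set_integrable_def by simp
qed

lemma lebesgue_ball_integral:
  fixes \<phi> :: "'a::euclidean_space \<Rightarrow> real"
  assumes "continuous_on UNIV \<phi>"
  shows "(LINT x:ball a \<rho>|lebesgue. \<phi> x) = (\<integral>x. indicator (ball a \<rho>) x * \<phi> x \<partial>lborel)"
proof -
  have [measurable]: "\<phi> \<in> borel_measurable borel" by (rule borel_measurable_continuous_onI[OF assms])
  have [measurable]: "ball a \<rho> \<in> sets borel" by simp
  show ?thesis unfolding set_lebesgue_integral_def by (subst integral_completion) auto
qed

text \<open>With \<open>ball_integral_le_bump_integral\<close> this sandwiches the test mass between
  masses on balls of radii \<rho>/2 and \<rho>. Halving the radius is harmless, since the singular
  sets quantify over all radii and the regular set asks for some radius.\<close>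

lemma bump_integral_le_ball_integral:
  fixes \<phi> :: "'a::euclidean_space \<Rightarrow> real"
  assumes \<phi>: "continuous_on UNIV \<phi>" "\<And>x. 0 \<le> \<phi> x" and \<rho>: "0 < \<rho>"
  shows "(\<integral>x. bump a \<rho> x * \<phi> x \<partial>lborel) \<le> (\<integral>x. indicator (ball a \<rho>) x * \<phi> x \<partial>lborel)"
proof (intro integral_mono integrable_bump_times_continuous integrable_continuous_on_bounded_set \<rho> \<phi>(1) mult_right_mono \<phi>(2))
  show "bump a \<rho> x \<le> indicator (ball a \<rho>) x" for x
    using bump_eq_0[OF \<rho>, of x a] bump_le_1[of a \<rho> x]
    by (auto simp: indicator_def dist_norm norm_minus_commute)
qed

lemma ball_integral_le_bump_integral:
  fixes \<phi> :: "'a::euclidean_space \<Rightarrow> real"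
  assumes \<phi>: "continuous_on UNIV \<phi>" "\<And>x. 0 \<le> \<phi> x" and \<rho>: "0 < \<rho>"
  shows "(\<integral>x. indicator (ball a (\<rho> / 2)) x * \<phi> x \<partial>lborel) \<le> 2 * (\<integral>x. bump a \<rho> x * \<phi> x \<partial>lborel)"
proof -
  have "(\<integral>x. indicator (ball a (\<rho> / 2)) x * \<phi> x \<partial>lborel) \<le> (\<integral>x. 2 * (bump a \<rho> x * \<phi> x) \<partial>lborel)"
  proof (intro integral_mono integrable_mult_right integrable_bump_times_continuous integrable_continuous_on_bounded_set \<rho> \<phi>(1))
    fix x
    have "indicator (ball a (\<rho> / 2)) x \<le> 2 * bump a \<rho> x"
      using bump_ge_half[of x a \<rho>] bump_nonneg[of a \<rho> x]
      by (auto simp: indicator_def dist_norm norm_minus_commute)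
    from mult_right_mono[OF this \<phi>(2)[of x]]
    show "indicator (ball a (\<rho> / 2)) x * \<phi> x \<le> 2 * (bump a \<rho> x * \<phi> x)"
      by (simp only: mult.assoc)
  qed
  then show ?thesis by simp
qed

lemma nn_integral_ball:
  fixes \<phi> :: "'a::euclidean_space \<Rightarrow> real"
  assumes \<phi>: "continuous_on UNIV \<phi>" "\<And>x. 0 \<le> \<phi> x"
  shows "(\<integral>\<^sup>+ x\<in>ball a \<rho>. ennreal (\<phi> x) \<partial>lebesgue) = ennreal (\<integral>x. indicator (ball a \<rho>) x * \<phi> x \<partial>lborel)"
proof -
  have "(\<integral>\<^sup>+ x\<in>ball a \<rho>. ennreal (\<phi> x) \<partial>lebesgue) = (\<integral>\<^sup>+ x. ennreal (indicator (ball a \<rho>) x * \<phi> x) \<partial>lborel)"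
    unfolding nn_integral_completion by (intro nn_integral_cong) (auto simp: indicator_def)
  also have "\<dots> = ennreal (\<integral>x. indicator (ball a \<rho>) x * \<phi> x \<partial>lborel)"
    by (intro nn_integral_eq_integral integrable_continuous_on_bounded_set \<phi>(1)) (simp add: \<phi>(2))
  finally show ?thesis .
qed

section \<open>Dependence of cutoff integrals on time\<close>

text \<open>The box is chosen before \<open>F\<close>, so one box serves all times t at once;
  continuity in a parameter and the Leibniz rule for integrals over a fixed box then apply.\<close>

lemma bump_integral_cbox:
  fixes a :: "'a::euclidean_space"
  assumes "0 < \<rho>"
  shows "\<exists>b. \<forall>F. continuous_on UNIV F \<longrightarrow>
    (\<integral>x. bump a \<rho> x * F x \<partial>lborel) = integral (cbox (- b) b) (\<lambda>x. bump a \<rho> x * F x)"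
proof -
  obtain b where b: "cball a \<rho> \<subseteq> cbox (- b) b"
    using bounded_subset_cbox_symmetric[OF bounded_cball] by blast
  show ?thesis
  proof (intro exI allI impI)
    fix F :: "'a \<Rightarrow> real" assume F: "continuous_on UNIV F"
    have "bump a \<rho> x = 0" if "x \<notin> cbox (- b) b" for x
    proof (rule bump_eq_0[OF assms])
      have "x \<notin> cball a \<rho>" using b that by blast
      then show "\<rho> \<le> norm (x - a)" by (simp add: dist_norm norm_minus_commute)
    qed
    then have "(\<lambda>x. bump a \<rho> x * F x) = (\<lambda>x. if x \<in> cbox (- b) b then bump a \<rho> x * F x else 0)"
      by auto
    then have "integral UNIV (\<lambda>x. bump a \<rho> x * F x) = integral (cbox (- b) b) (\<lambda>x. bump a \<rho> x * F x)"
      using integral_restrict_UNIV[of "cbox (- b) b" "\<lambda>x. bump a \<rho> x * F x"] by simp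
    then show "(\<integral>x. bump a \<rho> x * F x \<partial>lborel) = integral (cbox (- b) b) (\<lambda>x. bump a \<rho> x * F x)"
      using integral_lborel[OF integrable_bump_times_continuous[OF assms F]] by simp
  qed
qed

lemma continuous_on_bump_integral:
  fixes F :: "real \<Rightarrow> real^'n \<Rightarrow> real"
  assumes F: "continuous_on halfspace (\<lambda>(t, x). F t x)" and \<rho>: "0 < \<rho>"
  shows "continuous_on {0<..} (\<lambda>t. \<integral>x. bump a \<rho> x * F t x \<partial>lborel)"
proof -
  obtain b where b: "\<And>G. continuous_on UNIV G \<Longrightarrow>
      (\<integral>x. bump a \<rho> x * G x \<partial>lborel) = integral (cbox (- b) b) (\<lambda>x. bump a \<rho> x * G x)"
    using bump_integral_cbox[OF \<rho>, of a] by blast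
  have "continuous_on ({0<..} \<times> cbox (- b) b) (\<lambda>z. bump a \<rho> (snd z) * (case z of (t, x) \<Rightarrow> F t x))"
    by (intro continuous_on_mult continuous_on_subset[OF F]
          continuous_on_compose2[OF continuous_on_bump[of UNIV] continuous_on_snd[OF continuous_on_id]])
       (auto simp: halfspace_def)
  then have "continuous_on {0<..} (\<lambda>t. integral (cbox (- b) b) (\<lambda>x. bump a \<rho> x * F t x))"
    by (intro integral_continuous_on_param) (simp add: case_prod_unfold)
  then show ?thesis
    by (rule continuous_on_eq) (simp add: b continuous_on_halfspace_slice[OF F])
qed

lemma bump_integral_has_derivative:
  fixes F F' :: "real \<Rightarrow> real^'n \<Rightarrow> real"
  assumes F: "continuous_on halfspace (\<lambda>(t, x). F t x)" and F': "continuous_on halfspace (\<lambda>(t, x). F' t x)"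
    and deriv: "\<And>t x. 0 < t \<Longrightarrow> ((\<lambda>\<tau>. F \<tau> x) has_real_derivative F' t x) (at t)"
    and \<rho>: "0 < \<rho>" and t: "0 < t"
  shows "((\<lambda>t. \<integral>x. bump a \<rho> x * F t x \<partial>lborel) has_real_derivative (\<integral>x. bump a \<rho> x * F' t x \<partial>lborel)) (at t)"
proof -
  obtain b where b: "\<And>G. continuous_on UNIV G \<Longrightarrow>
      (\<integral>x. bump a \<rho> x * G x \<partial>lborel) = integral (cbox (- b) b) (\<lambda>x. bump a \<rho> x * G x)"
    using bump_integral_cbox[OF \<rho>, of a] by blast
  have "((\<lambda>t. integral (cbox (- b) b) (\<lambda>x. bump a \<rho> x * F t x)) has_field_derivative
      integral (cbox (- b) b) (\<lambda>x. bump a \<rho> x * F' t x)) (at t within {0<..})"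
  proof (rule leibniz_rule_field_derivative)
    show "((\<lambda>t. bump a \<rho> x * F t x) has_field_derivative bump a \<rho> x * F' t x) (at t within {0<..})"
      if "t \<in> {0<..}" for t x
      using that by (intro DERIV_cmult has_field_derivative_at_within[OF deriv]) auto
    show "(\<lambda>x. bump a \<rho> x * F t x) integrable_on cbox (- b) b" if "t \<in> {0<..}" for t
      using that
      by (intro integrable_continuous continuous_intros continuous_on_bump
            continuous_on_subset[OF continuous_on_halfspace_slice[OF F]]) auto
    have "continuous_on ({0<..} \<times> cbox (- b) b) (\<lambda>z. bump a \<rho> (snd z) * (case z of (t, x) \<Rightarrow> F' t x))"
      by (intro continuous_on_mult continuous_on_subset[OF F']
            continuous_on_compose2[OF continuous_on_bump[of UNIV] continuous_on_snd[OF continuous_on_id]])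
         (auto simp: halfspace_def)
    then show "continuous_on ({0<..} \<times> cbox (- b) b) (\<lambda>(t, x). bump a \<rho> x * F' t x)"
      by (simp add: case_prod_unfold)
  qed (use t in auto)
  then have "((\<lambda>t. integral (cbox (- b) b) (\<lambda>x. bump a \<rho> x * F t x)) has_real_derivative
      (\<integral>x. bump a \<rho> x * F' t x \<partial>lborel)) (at t within {0<..})"
    using t by (simp add: b continuous_on_halfspace_slice[OF F'])
  then have "((\<lambda>t. \<integral>x. bump a \<rho> x * F t x \<partial>lborel) has_real_derivative
      (\<integral>x. bump a \<rho> x * F' t x \<partial>lborel)) (at t within {0<..})"
    by (rule has_field_derivative_transform_within[OF _ zero_less_one])
       (use t in \<open>auto simp: b continuous_on_halfspace_slice[OF F]\<close>)
  then show ?thesis using t at_within_open[of t "{0<..}"] by simp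
qed

section \<open>Time integrals of a nonnegative density\<close>

lemma nn_integral_Icc:
  fixes G :: "real \<Rightarrow> real"
  assumes "continuous_on {a..b} G" "\<And>t. t \<in> {a..b} \<Longrightarrow> 0 \<le> G t"
  shows "(\<integral>\<^sup>+ t\<in>{a..b}. ennreal (G t) \<partial>lborel) = ennreal (integral {a..b} G)"
proof -
  have i: "set_integrable lborel {a..b} G"
    unfolding set_integrable_def by (rule borel_integrable_compact) (use assms in auto)
  have "(\<integral>\<^sup>+ t\<in>{a..b}. ennreal (G t) \<partial>lborel) = (\<integral>\<^sup>+ t. ennreal (indicator {a..b} t *\<^sub>R G t) \<partial>lborel)"
    by (intro nn_integral_cong) (auto simp: indicator_def)
  also have "\<dots> = ennreal (\<integral>t. indicator {a..b} t *\<^sub>R G t \<partial>lborel)"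
    by (intro nn_integral_eq_integral i[unfolded set_integrable_def] AE_I2)
       (auto simp: indicator_def assms(2))
  also have "\<dots> = ennreal (integral {a..b} G)"
    using set_borel_integral_eq_integral(2)[OF i] by (simp add: set_lebesgue_integral_def)
  finally show ?thesis .
qed

text \<open>Since G is nonnegative, the integral over [a,b] grows as a decreases. If it stayed below
  Z for all a, monotone convergence would bound the integral over (0,1].\<close>

lemma integral_unbounded_of_nn_integral_top:
  fixes G :: "real \<Rightarrow> real"
  assumes G: "continuous_on {0<..} G" "\<And>t. 0 < t \<Longrightarrow> 0 \<le> G t"
    and top: "(\<integral>\<^sup>+ t\<in>{0<..<1}. ennreal (G t) \<partial>lborel) = \<infinity>" and b: "0 < b" "b < 1"
  shows "\<exists>a0. 0 < a0 \<and> a0 < b \<and> (\<forall>a. 0 < a \<longrightarrow> a \<le> a0 \<longrightarrow> Z \<le> integral {a..b} G)"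
proof -
  have cont: "continuous_on {a..c} G" if "0 < a" for a c
    by (rule continuous_on_subset[OF G(1)]) (use that in auto)
  have int: "G integrable_on {a..c}" if "0 < a" for a c
    by (intro integrable_continuous_interval cont that)
  have "\<exists>a0. 0 < a0 \<and> a0 < b \<and> Z \<le> integral {a0..b} G"
  proof (rule ccontr)
    assume "\<not> ?thesis"
    then have less: "integral {a..b} G \<le> Z" if "0 < a" "a < b" for a
      using that by force
    \<comment> \<open>The shift by 2 makes every left endpoint strictly smaller than b, also for n =
      0, as \<open>less\<close> demands. In \<open>B\<close> the piece over [b,1] is finite because
      G is continuous away from 0.\<close>
    define f where "f n t = ennreal (indicator {b / real (n + 2)..1} t * G t)" for n t
    define B where "B = Z + integral {b..1} G"
    have an: "0 < b / real (n + 2)" "b / real (n + 2) < b" for n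
      using b by (auto simp: divide_less_eq algebra_simps intro: add_pos_nonneg)
    have "(\<integral>\<^sup>+ t. f n t \<partial>lborel) \<le> ennreal B" for n
    proof -
      have "(\<integral>\<^sup>+ t. f n t \<partial>lborel) = (\<integral>\<^sup>+ t\<in>{b / real (n + 2)..1}. ennreal (G t) \<partial>lborel)"
        unfolding f_def by (intro nn_integral_cong) (auto simp: indicator_def)
      also have "\<dots> = ennreal (integral {b / real (n + 2)..1} G)"
        using an[of n] by (intro nn_integral_Icc cont G(2)) (auto intro: less_le_trans)
      also have "\<dots> \<le> ennreal B"
        unfolding B_def
        using Henstock_Kurzweil_Integration.integral_combine[OF less_imp_le[OF an(2)] less_imp_le[OF b(2)] int[OF an(1)], of n]
          less[OF an, of n] by (intro ennreal_leI) linarith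
      finally show ?thesis .
    qed
    moreover have "(\<lambda>n. \<integral>\<^sup>+ t. f n t \<partial>lborel) \<longlonglongrightarrow> (\<integral>\<^sup>+ t. ennreal (indicator {0<..1} t * G t) \<partial>lborel)"
    proof (rule nn_integral_LIMSEQ)
      show "incseq f"
        unfolding incseq_def le_fun_def f_def
      proof (intro allI impI ennreal_leI)
        fix m n :: nat and t :: real assume mn: "m \<le> n"
        have "b / real (n + 2) \<le> b / real (m + 2)"
          using mn b by (intro divide_left_mono) auto
        then show "indicator {b / real (m + 2)..1} t * G t \<le> indicator {b / real (n + 2)..1} t * G t"
          using an(1)[of n] G(2)[of t] by (auto simp: indicator_def)
      qed
      show "f n \<in> borel_measurable lborel" for n
      proof -
        have "(\<lambda>t. indicator {b / real (n + 2)..1} t *\<^sub>R G t) \<in> borel_measurable borel"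
          by (intro borel_measurable_continuous_on_indicator cont an) simp
        then show ?thesis unfolding f_def by simp
      qed
      show "(\<lambda>n. f n t) \<longlonglongrightarrow> ennreal (indicator {0<..1} t * G t)" for t
      proof (rule tendsto_eventually)
        have "(\<lambda>n. b / real (n + 2)) \<longlonglongrightarrow> 0" using LIMSEQ_ignore_initial_segment[OF lim_const_over_n[of b], of 2] by simp
        show "\<forall>\<^sub>F n in sequentially. f n t = ennreal (indicator {0<..1} t * G t)"
        proof (cases "0 < t")
          case True
          have "\<forall>\<^sub>F n in sequentially. b / real (n + 2) < t"
            by (rule order_tendstoD(2)[OF \<open>(\<lambda>n. b / real (n + 2)) \<longlonglongrightarrow> 0\<close> True])
          then show ?thesis
            by eventually_elim (use True in \<open>auto simp: f_def indicator_def\<close>)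
        next
          case False
          have "f n t = ennreal (indicator {0<..1} t * G t)" for n
          proof -
            have "\<not> b / real (n + 2) \<le> t" using an(1)[of n] False by linarith
            then show ?thesis using False by (simp add: f_def indicator_def)
          qed
          then show ?thesis by simp
        qed
      qed
    qed
    ultimately have "(\<integral>\<^sup>+ t. ennreal (indicator {0<..1} t * G t) \<partial>lborel) \<le> ennreal B"
      by (intro LIMSEQ_le_const2) auto
    moreover have "(\<integral>\<^sup>+ t\<in>{0<..<1}. ennreal (G t) \<partial>lborel) \<le> (\<integral>\<^sup>+ t. ennreal (indicator {0<..1} t * G t) \<partial>lborel)"
      by (intro nn_integral_mono) (auto simp: indicator_def)
    ultimately show False using top by (simp add: top_unique)
  qed
  then obtain a0 where a0: "0 < a0" "a0 < b" "Z \<le> integral {a0..b} G" by blast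
  have "Z \<le> integral {a..b} G" if a: "0 < a" "a \<le> a0" for a
  proof -
    have "integral {a0..b} G \<le> integral {a..b} G"
      using a a0 by (intro integral_subset_le int) (auto intro: G(2) less_le_trans)
    then show ?thesis using a0(3) by linarith
  qed
  then show ?thesis using a0 by blast
qed

section \<open>Integrability of the kernel\<close>

text \<open>With m = max \<epsilon> |z - x| one has |z| \<le> m + R \<le> (1 + R/\<epsilon>) m and 1
  \<le> m^p / \<epsilon>^p; adding the p-th powers gives the constant. Uniformity over |x| \<le> R
  supplies majorants that do not move with x.\<close>

lemma reg_kernel_le_decay:
  assumes "0 < \<epsilon>" "0 \<le> R" "0 \<le> p"
  shows "\<exists>C>0. \<forall>x z :: 'a::real_normed_vector. norm x \<le> R \<longrightarrow> reg_kernel p \<epsilon> (z - x) \<le> C * decay p z"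
proof (intro exI conjI allI impI)
  let ?C = "1 / \<epsilon> powr p + (1 + R / \<epsilon>) powr p"
  show "0 < ?C" using assms by (auto intro!: add_pos_nonneg)
  fix x z :: 'a assume x: "norm x \<le> R"
  let ?m = "max \<epsilon> (norm (z - x))"
  have m: "0 < ?m" using assms by auto
  have "norm z \<le> norm (z - x) + R" using x norm_triangle_sub[of z x] by linarith
  also have "\<dots> \<le> ?m + R / \<epsilon> * ?m"
    using mult_left_mono[of \<epsilon> ?m "R / \<epsilon>"] assms by auto
  finally have "norm z \<le> (1 + R / \<epsilon>) * ?m" by (simp add: algebra_simps)
  then have "norm z powr p \<le> ((1 + R / \<epsilon>) * ?m) powr p"
    using assms by (intro powr_mono2) auto
  also have "\<dots> = (1 + R / \<epsilon>) powr p * ?m powr p"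
    using assms m by (intro powr_mult)
  finally have a: "norm z powr p \<le> (1 + R / \<epsilon>) powr p * ?m powr p" .
  have "\<epsilon> powr p \<le> ?m powr p" using assms by (intro powr_mono2) auto
  then have "1 \<le> 1 / \<epsilon> powr p * ?m powr p" using assms by simp
  then have "1 + norm z powr p \<le> ?C * ?m powr p" using a by (simp add: algebra_simps)
  then have "1 / ?m powr p \<le> ?C / (1 + norm z powr p)"
    using m by (simp add: field_simps add_pos_nonneg)
  then show "reg_kernel p \<epsilon> (z - x) \<le> ?C * decay p z"
    unfolding reg_kernel_def decay_def by simp
qed

lemma decay_ge_on_cball:
  assumes "0 \<le> R" "0 \<le> p"
  shows "\<exists>C>0. \<forall>x :: 'a::real_normed_vector. norm x \<le> R \<longrightarrow> 1 \<le> C * decay p x"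
proof (intro exI conjI allI impI)
  show "0 < 1 + R powr p" by (simp add: add_pos_nonneg)
  fix x :: 'a assume "norm x \<le> R"
  then have "norm x powr p \<le> R powr p" using assms by (intro powr_mono2) auto
  then show "1 \<le> (1 + R powr p) * decay p x"
    unfolding decay_def by (simp add: add_pos_nonneg field_simps)
qed

lemma integrable_reg_kernel_times:
  fixes \<phi> :: "'a::euclidean_space \<Rightarrow> real"
  assumes [measurable]: "\<phi> \<in> borel_measurable borel"
    and \<phi>: "integrable lborel (\<lambda>x. \<phi> x * decay p x)" and "0 < \<epsilon>" "0 \<le> p"
  shows "integrable lborel (\<lambda>z. reg_kernel p \<epsilon> (z - x) * \<phi> z)"
    and "integrable lborel (\<lambda>z. trunc_kernel p \<epsilon> (z - x) * \<phi> z)"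
proof -
  obtain C where "0 < C" "\<forall>y z :: 'a. norm y \<le> norm x \<longrightarrow> reg_kernel p \<epsilon> (z - y) \<le> C * decay p z"
    using reg_kernel_le_decay[OF \<open>0 < \<epsilon>\<close> norm_ge_zero[of x] \<open>0 \<le> p\<close>, where 'a = 'a] by blast
  then have C: "0 < C" "\<And>z :: 'a. reg_kernel p \<epsilon> (z - x) \<le> C * decay p z" by auto
  have b: "reg_kernel p \<epsilon> (z - x) * \<bar>\<phi> z\<bar> \<le> C * (\<bar>\<phi> z\<bar> * decay p z)" for z
    using mult_right_mono[OF C(2)[of z], of "\<bar>\<phi> z\<bar>"] by (simp add: mult_ac)
  have b': "trunc_kernel p \<epsilon> (z - x) * \<bar>\<phi> z\<bar> \<le> C * (\<bar>\<phi> z\<bar> * decay p z)" for z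
    using mult_right_mono[OF trunc_kernel_le_reg_kernel, of "\<bar>\<phi> z\<bar>" p \<epsilon> "z - x"] b[of z] by simp
  have i: "integrable lborel (\<lambda>z. C * (\<phi> z * decay p z))" using \<phi> by simp
  show "integrable lborel (\<lambda>z. reg_kernel p \<epsilon> (z - x) * \<phi> z)"
    by (rule Bochner_Integration.integrable_bound[OF i])
       (use b C(1) in \<open>auto simp: abs_mult reg_kernel_nonneg decay_pos less_imp_le\<close>)
  show "integrable lborel (\<lambda>z. trunc_kernel p \<epsilon> (z - x) * \<phi> z)"
    by (rule Bochner_Integration.integrable_bound[OF i])
       (use b' C(1) in \<open>auto simp: abs_mult trunc_kernel_nonneg decay_pos less_imp_le\<close>)
qed

lemma tendsto_reg_kernel:
  assumes "0 < \<epsilon>" "(X \<longlongrightarrow> x) F"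
  shows "((\<lambda>n. reg_kernel p \<epsilon> (X n)) \<longlongrightarrow> reg_kernel p \<epsilon> x) F"
  unfolding reg_kernel_def using assms by (intro tendsto_intros) auto

text \<open>A convergent sequence of points is bounded, so \<open>reg_kernel_le_decay\<close> gives
  a single majorant along it; the pointwise limit relies on the continuity of the regularised
  kernel.\<close>

lemma continuous_on_reg_kernel_convolution:
  fixes \<phi> :: "'a::euclidean_space \<Rightarrow> real"
  assumes [measurable]: "\<phi> \<in> borel_measurable borel"
    and \<phi>: "integrable lborel (\<lambda>x. \<phi> x * decay p x)" and "0 < \<epsilon>" "0 \<le> p"
  shows "continuous_on UNIV (\<lambda>x. \<integral>z. reg_kernel p \<epsilon> (z - x) * \<phi> z \<partial>lborel)"
  unfolding continuous_on_sequentially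
proof (intro allI ballI impI)
  fix X x assume "(\<forall>n. X n \<in> UNIV) \<and> X \<longlonglongrightarrow> (x::'a)"
  then have X: "X \<longlonglongrightarrow> x" by simp
  then have "bounded (range X)" by (metis convergentI convergent_imp_bounded)
  then obtain R where R: "\<And>n. norm (X n) \<le> R" unfolding bounded_iff by auto
  then have R0: "0 \<le> R" using norm_ge_zero order.trans by blast
  obtain C where "0 < C" "\<forall>y z :: 'a. norm y \<le> R \<longrightarrow> reg_kernel p \<epsilon> (z - y) \<le> C * decay p z"
    using reg_kernel_le_decay[OF \<open>0 < \<epsilon>\<close> R0 \<open>0 \<le> p\<close>, where 'a = 'a] by blast
  then have C: "0 < C" "\<And>n z. reg_kernel p \<epsilon> (z - X n) \<le> C * decay p z" using R by auto
  have "(\<lambda>n. \<integral>z. reg_kernel p \<epsilon> (z - X n) * \<phi> z \<partial>lborel) \<longlonglongrightarrow> (\<integral>z. reg_kernel p \<epsilon> (z - x) * \<phi> z \<partial>lborel)"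
  proof (rule integral_dominated_convergence)
    show "integrable lborel (\<lambda>z. C * \<bar>\<phi> z * decay p z\<bar>)" using \<phi> by simp
    show "AE z in lborel. (\<lambda>n. reg_kernel p \<epsilon> (z - X n) * \<phi> z) \<longlonglongrightarrow> reg_kernel p \<epsilon> (z - x) * \<phi> z"
      using X \<open>0 < \<epsilon>\<close> by (intro AE_I2 tendsto_mult tendsto_reg_kernel tendsto_diff tendsto_const)
    show "AE z in lborel. norm (reg_kernel p \<epsilon> (z - X n) * \<phi> z) \<le> C * \<bar>\<phi> z * decay p z\<bar>" for n
    proof (rule AE_I2)
      fix z
      show "norm (reg_kernel p \<epsilon> (z - X n) * \<phi> z) \<le> C * \<bar>\<phi> z * decay p z\<bar>"
        using mult_right_mono[OF C(2)[of z n], of "\<bar>\<phi> z\<bar>"]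
        by (simp add: abs_mult reg_kernel_nonneg decay_pos less_imp_le mult_ac)
    qed
  qed simp_all
  then show "((\<lambda>x. \<integral>z. reg_kernel p \<epsilon> (z - x) * \<phi> z \<partial>lborel) \<circ> X) \<longlonglongrightarrow> (\<integral>z. reg_kernel p \<epsilon> (z - x) * \<phi> z \<partial>lborel)"
    by (simp add: o_def)
qed

lemma compact_support_uniformly_continuous:
  fixes v :: "'a::euclidean_space \<Rightarrow> real"
  assumes v: "continuous_on UNIV v" and supp: "\<And>x. R \<le> norm (x - a) \<Longrightarrow> v x = 0"
  shows "uniformly_continuous_on UNIV v" and "\<exists>M. \<forall>x. \<bar>v x\<bar> \<le> M"
proof -
  have uc: "uniformly_continuous_on (cball a (R + 1)) v"
    by (intro compact_uniformly_continuous continuous_on_subset[OF v]) auto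
  show "uniformly_continuous_on UNIV v"
    unfolding uniformly_continuous_on_def
  proof (intro allI impI)
    fix e :: real assume e: "0 < e"
    then obtain d where d: "0 < d" "\<And>x y. x \<in> cball a (R + 1) \<Longrightarrow> y \<in> cball a (R + 1) \<Longrightarrow> dist y x < d \<Longrightarrow> dist (v y) (v x) < e"
      using uc unfolding uniformly_continuous_on_def by metis
    \<comment> \<open>The cap 1 matches the enlarged radius R + 1: if one of the two points leaves
      the larger ball, both are at distance at least R from the centre, where v vanishes.\<close>
    have "dist (v y) (v x) < e" if xy: "dist y x < min d 1" for x y
    proof (cases "x \<in> cball a (R + 1) \<and> y \<in> cball a (R + 1)")
      case False
      then have "R \<le> norm (x - a)" "R \<le> norm (y - a)"
        using xy dist_triangle[of a x y] dist_triangle[of a y x]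
        by (auto simp: dist_norm norm_minus_commute)
      then show ?thesis using supp e by simp
    qed (use d xy in auto)
    then show "\<exists>d>0. \<forall>x\<in>UNIV. \<forall>x'\<in>UNIV. dist x' x < d \<longrightarrow> dist (v x') (v x) < e"
      using d(1) by (intro exI[of _ "min d 1"]) auto
  qed
  have "bounded (v ` cball a R)"
    by (intro compact_imp_bounded compact_continuous_image continuous_on_subset[OF v]) auto
  then obtain M where "\<forall>x\<in>cball a R. \<bar>v x\<bar> \<le> M" unfolding bounded_iff by auto
  then have M: "\<bar>v x\<bar> \<le> M" if "x \<in> cball a R" for x using that by blast
  have "\<bar>v x\<bar> \<le> max M 0" for x
    using M[of x] supp[of x] by (cases "x \<in> cball a R") (auto simp: dist_norm norm_minus_commute)
  then show "\<exists>M. \<forall>x. \<bar>v x\<bar> \<le> M" by blast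
qed

lemma integrable_times_decay_bound:
  fixes \<phi> \<theta> :: "'a::euclidean_space \<Rightarrow> real"
  assumes [measurable]: "\<phi> \<in> borel_measurable borel" "\<theta> \<in> borel_measurable borel"
    and \<phi>: "integrable lborel (\<lambda>x. \<phi> x * decay p x)"
    and le: "\<And>x. \<bar>\<theta> x\<bar> \<le> C * decay p x"
  shows "integrable lborel (\<lambda>x. \<phi> x * \<theta> x)"
proof (rule Bochner_Integration.integrable_bound)
  show "integrable lborel (\<lambda>x. C * (\<phi> x * decay p x))" using \<phi> by simp
  show "AE x in lborel. norm (\<phi> x * \<theta> x) \<le> norm (C * (\<phi> x * decay p x))"
  proof (rule AE_I2)
    fix x
    have "\<bar>\<theta> x\<bar> \<le> \<bar>C * decay p x\<bar>" using le[of x] by linarith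
    then have "\<bar>\<phi> x\<bar> * \<bar>\<theta> x\<bar> \<le> \<bar>\<phi> x\<bar> * \<bar>C * decay p x\<bar>" by (rule mult_left_mono) simp
    then show "norm (\<phi> x * \<theta> x) \<le> norm (C * (\<phi> x * decay p x))" by (simp add: abs_mult mult_ac)
  qed
qed simp

section \<open>Integrability of power kernels by dyadic balls\<close>

text \<open>Pointwise f lies below the sum of the functions with height c j on the ball of radius r
  j, and that sum has integral equal to the volume of the unit ball times the given series. This
  takes the place of polar coordinates.\<close>

lemma integrable_dyadic_majorant:
  fixes f :: "'a::euclidean_space \<Rightarrow> real"
  assumes [measurable]: "f \<in> borel_measurable borel"
    and f0: "\<And>z. 0 \<le> f z"
    and f_le: "\<And>z. f z \<noteq> 0 \<Longrightarrow> \<exists>j. z \<in> ball 0 (r j) \<and> f z \<le> c j"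
    and c0: "\<And>j::nat. 0 \<le> c j" and r0: "\<And>j. 0 \<le> r j"
    and sm: "summable (\<lambda>j. c j * r j ^ DIM('a))"
  shows "integrable lborel f"
proof (rule integrableI_nonneg)
  let ?g = "\<lambda>j z. ennreal (c j) * indicator (ball 0 (r j)) (z::'a)"
  have pw: "ennreal (f z) \<le> (\<Sum>j. ?g j z)" for z
  proof (cases "f z = 0")
    case False
    then obtain j where j: "z \<in> ball 0 (r j)" "f z \<le> c j" using f_le by blast
    have "ennreal (f z) \<le> ?g j z" using j by (simp add: ennreal_leI)
    also have "\<dots> \<le> (\<Sum>j. ?g j z)"
    proof -
      have "h j \<le> (\<Sum>j. h j)" for h :: "nat \<Rightarrow> ennreal"
        using sum_le_suminf[OF summableI, of "{j}" h] by simp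
      then show ?thesis .
    qed
    finally show ?thesis .
  qed simp
  have "(\<integral>\<^sup>+ z. ennreal (f z) \<partial>lborel) \<le> (\<integral>\<^sup>+ z. (\<Sum>j. ?g j z) \<partial>lborel)"
    by (intro nn_integral_mono pw)
  also have "\<dots> = (\<Sum>j. \<integral>\<^sup>+ z. ?g j z \<partial>lborel)"
  proof (rule nn_integral_suminf)
    show "?g j \<in> borel_measurable lborel" for j
      by (rule borel_measurable_times_ennreal[OF borel_measurable_const borel_measurable_indicator]) simp
  qed
  also have "\<dots> = (\<Sum>j. ennreal (unit_ball_vol DIM('a) * (c j * r j ^ DIM('a))))"
    by (intro suminf_cong)
       (simp add: nn_integral_cmult_indicator emeasure_ball r0 ennreal_mult'[symmetric] c0 mult_ac)
  also have "\<dots> < \<infinity>"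
  proof -
    have "(\<Sum>j. ennreal (unit_ball_vol DIM('a) * (c j * r j ^ DIM('a)))) \<noteq> top"
      by (rule ennreal_suminf_neq_top) (simp_all add: sm summable_mult c0 r0)
    then show ?thesis by (simp add: less_top)
  qed
  finally show "(\<integral>\<^sup>+ z. ennreal (f z) \<partial>lborel) < \<infinity>" .
qed (use f0 in auto)

lemma dyadic_bounds:
  fixes r :: real
  assumes "1 \<le> r"
  shows "\<exists>j::nat. 2 ^ j \<le> r \<and> r < 2 ^ Suc j"
proof -
  define j where "j = nat \<lfloor>log 2 r\<rfloor>"
  have "0 \<le> log 2 r" using assms by simp
  then have "real j \<le> log 2 r" "log 2 r < real (Suc j)"
    unfolding j_def by linarith+
  then have "2 powr real j \<le> r" "r < 2 powr real (Suc j)"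
    using assms by (auto simp: le_log_iff log_less_iff)
  then show ?thesis by (metis powr_realpow zero_less_numeral)
qed

text \<open>The condition p > N gives convergence at infinity and p < N + 2 at the origin: the
  dyadic sums are geometric with ratios 2^(N-p) and 2^(p-N-2). The numerator is the size of a second
  difference.\<close>

lemma integrable_riesz_kernel:
  assumes p: "real DIM('a::euclidean_space) < p" "p < real DIM('a) + 2"
  shows "integrable lborel (\<lambda>z::'a. min 1 ((norm z)\<^sup>2) / norm z powr p)"
proof -
  let ?d = "DIM('a)"
  let ?J = "\<lambda>z::'a. min 1 ((norm z)\<^sup>2) / norm z powr p"
  have pw: "((2::real) ^ j) powr p = (2 powr p) ^ j" for j
    by (induction j) (auto simp: powr_mult)
  have comm: "((2::real) ^ j) ^ k = (2 ^ k) ^ j" for j k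
    by (simp only: power_mult[symmetric] mult.commute)
  have out: "integrable lborel (\<lambda>z::'a. if 1 \<le> norm z then ?J z else 0)"
  proof (rule integrable_dyadic_majorant[where c = "\<lambda>j. 1 / (2 ^ j) powr p" and r = "\<lambda>j. 2 ^ Suc j"])
    fix z :: 'a assume "(if 1 \<le> norm z then ?J z else 0) \<noteq> 0"
    then have z: "1 \<le> norm z" by (auto split: if_splits)
    then obtain j where j: "2 ^ j \<le> norm z" "norm z < 2 ^ Suc j" using dyadic_bounds by blast
    have "?J z \<le> 1 / (2 ^ j) powr p"
      using j p by (intro frac_le powr_mono2) auto
    then show "\<exists>j. z \<in> ball 0 (2 ^ Suc j) \<and> (if 1 \<le> norm z then ?J z else 0) \<le> 1 / (2 ^ j) powr p"
      using z j by auto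
  next
    have "2 powr (real ?d - p) = 2 ^ ?d / 2 powr p"
      by (simp add: powr_diff powr_realpow)
    then have "(1 / (2 ^ j) powr p) * (2 ^ Suc j) ^ ?d = 2 ^ ?d * (2 powr (real ?d - p)) ^ j" for j
      by (simp add: pw comm[of j] power_divide power_mult_distrib)
    moreover have "summable (\<lambda>j. 2 ^ ?d * (2 powr (real ?d - p)) ^ j :: real)"
      using p powr_less_one[of 2 "real ?d - p"] by (intro summable_mult summable_geometric) auto
    ultimately show "summable (\<lambda>j. (1 / (2 ^ j) powr p) * (2 ^ Suc j) ^ ?d :: real)" by simp
  qed auto
  have ins: "integrable lborel (\<lambda>z::'a. if norm z < 1 then ?J z else 0)"
  \<comment> \<open>On the shell 2^-(j+1) \<le> |z| \<le> 2^-j the numerator is bounded at the outer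
    radius and the denominator at the inner one. The radius is doubled because the balls are open
    and the outer sphere may be hit.\<close>
  proof (rule integrable_dyadic_majorant[where c = "\<lambda>j. (1 / 2 ^ j)\<^sup>2 * (2 * 2 ^ j) powr p" and r = "\<lambda>j. 2 * (1 / 2 ^ j)"])
    fix z :: 'a assume nz: "(if norm z < 1 then ?J z else 0) \<noteq> 0"
    then have z: "norm z < 1" "z \<noteq> 0" by (auto split: if_splits)
    then have "1 \<le> 1 / norm z" by (simp add: field_simps)
    then obtain j where j: "2 ^ j \<le> 1 / norm z" "1 / norm z < 2 ^ Suc j" using dyadic_bounds by blast
    have a: "norm z \<le> 1 / 2 ^ j" using j z by (simp add: field_simps)
    have b: "1 / (2 * 2 ^ j) \<le> norm z" using j z by (simp add: field_simps)
    have "(norm z)\<^sup>2 / norm z powr p \<le> (1 / 2 ^ j)\<^sup>2 / (1 / (2 * 2 ^ j)) powr p"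
      using a b p by (intro frac_le powr_mono2 power_mono) auto
    moreover have "?J z \<le> (norm z)\<^sup>2 / norm z powr p"
      by (intro divide_right_mono) auto
    ultimately have "?J z \<le> (1 / 2 ^ j)\<^sup>2 * (2 * 2 ^ j) powr p"
      by (simp add: powr_divide)
    moreover have "norm z < 2 * (1 / 2 ^ j)"
      using a by (rule order.strict_trans1) (simp add: field_simps)
    ultimately show "\<exists>j. z \<in> ball 0 (2 * (1 / 2 ^ j)) \<and> (if norm z < 1 then ?J z else 0) \<le> (1 / 2 ^ j)\<^sup>2 * (2 * 2 ^ j) powr p"
      using z by auto
  next
    have "2 powr (p - real ?d - 2) = 2 powr p / (2 ^ ?d * 2 ^ 2)"
      by (simp add: powr_diff powr_realpow)
    then have "((1 / 2 ^ j)\<^sup>2 * (2 * 2 ^ j) powr p) * (2 * (1 / 2 ^ j)) ^ ?d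
        = (2 powr p * 2 ^ ?d) * (2 powr (p - real ?d - 2)) ^ j" for j
      by (simp add: powr_mult pw comm[of j] power_divide power_mult_distrib mult_ac)
    moreover have "summable (\<lambda>j. (2 powr p * 2 ^ ?d) * (2 powr (p - real ?d - 2)) ^ j :: real)"
      using p powr_less_one[of 2 "p - real ?d - 2"] by (intro summable_mult summable_geometric) auto
    ultimately show "summable (\<lambda>j. ((1 / 2 ^ j)\<^sup>2 * (2 * 2 ^ j) powr p) * (2 * (1 / 2 ^ j)) ^ ?d :: real)"
      by simp
  qed auto
  have "integrable lborel (\<lambda>z::'a. (if 1 \<le> norm z then ?J z else 0) + (if norm z < 1 then ?J z else 0))"
    by (intro Bochner_Integration.integrable_add out ins)
  then show ?thesis
    by (rule Bochner_Integration.integrable_cong[THEN iffD1, rotated -1]) auto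
qed

lemma integrable_decay:
  assumes p: "real DIM('a::euclidean_space) < p" "p < real DIM('a) + 2"
  shows "integrable lborel (decay p :: 'a \<Rightarrow> real)"
proof (rule Bochner_Integration.integrable_bound)
  let ?J = "\<lambda>z::'a. min 1 ((norm z)\<^sup>2) / norm z powr p"
  show "integrable lborel (\<lambda>z::'a. indicator (cball 0 1) z + ?J z)"
  proof (intro Bochner_Integration.integrable_add integrable_riesz_kernel p integrable_real_indicator)
    show "emeasure lborel (cball (0::'a) 1) < \<infinity>" by (rule emeasure_bounded_finite) simp
  qed simp
  show "AE z in lborel. norm (decay p z) \<le> norm (indicator (cball 0 1) z + ?J (z::'a))"
  proof (rule AE_I2)
    fix z :: 'a
    show "norm (decay p z) \<le> norm (indicator (cball 0 1) z + ?J z)"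
    proof (cases "norm z \<le> 1")
      case True
      have "decay p z \<le> 1 + ?J z" by (intro add_increasing2 decay_le_1) simp
      then show ?thesis using True decay_pos[of p z] by simp
    next
      case False
      then have "?J z = 1 / norm z powr p" by (simp add: min_def power_le_one_iff)
      moreover have "decay p z \<le> 1 / norm z powr p"
        unfolding decay_def using False by (intro divide_left_mono mult_pos_pos) (auto intro: add_pos_nonneg)
      ultimately show ?thesis using False decay_pos[of p z] by simp
    qed
  qed
qed simp

lemma integrable_trunc_kernel:
  assumes p: "real DIM('a::euclidean_space) < p" "p < real DIM('a) + 2" and "0 < \<epsilon>"
  shows "integrable lborel (trunc_kernel p \<epsilon> :: 'a \<Rightarrow> real)"
proof -
  have "0 \<le> p" using p by (simp add: order.trans[OF _ less_imp_le[OF p(1)]])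
  then obtain C where "\<forall>x z :: 'a. norm x \<le> 0 \<longrightarrow> reg_kernel p \<epsilon> (z - x) \<le> C * decay p z"
    using reg_kernel_le_decay[OF \<open>0 < \<epsilon>\<close> order_refl, of p, where 'a = 'a] by blast
  from this[rule_format, of 0] have C: "reg_kernel p \<epsilon> z \<le> C * decay p z" for z :: 'a by simp
  show ?thesis
  proof (rule Bochner_Integration.integrable_bound)
    show "integrable lborel (\<lambda>z::'a. C * decay p z)" by (simp add: integrable_decay p)
    show "AE z in lborel. norm (trunc_kernel p \<epsilon> z) \<le> norm (C * decay p (z::'a))"
    proof (rule AE_I2)
      fix z :: 'a
      show "norm (trunc_kernel p \<epsilon> z) \<le> norm (C * decay p z)"
        using order.trans[OF trunc_kernel_le_reg_kernel C, of z] trunc_kernel_nonneg[of p \<epsilon> z] by simp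
    qed
  qed simp
qed

section \<open>Reflection and symmetrised truncations\<close>

lemma lborel_distr_minus: "distr lborel borel uminus = (lborel :: 'a::euclidean_space measure)"
  using lborel_affine[of "-1" "0::'a"] by (simp add: density_1 one_ennreal_def[symmetric])

lemma integrable_reflect:
  fixes f :: "'a::euclidean_space \<Rightarrow> real"
  assumes "integrable lborel f"
  shows "integrable lborel (\<lambda>z. f (- z))"
proof -
  have "integrable (distr lborel borel uminus) f" using assms by (simp add: lborel_distr_minus)
  then show ?thesis by (rule integrable_distr[rotated]) simp
qed

lemma integral_reflect:
  fixes f :: "'a::euclidean_space \<Rightarrow> real"
  assumes [measurable]: "f \<in> borel_measurable borel"
  shows "(\<integral>z. f (- z) \<partial>lborel) = (\<integral>z. f z \<partial>lborel)"
  using integral_distr[of uminus lborel borel f] by (simp add: lborel_distr_minus)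

text \<open>Away from the origin the kernel is integrable, so the difference may be split:
  multiplication by the mass of the kernel minus a convolution. Neither term survives \<epsilon> to
  0 on its own.\<close>

lemma trunc_lap_eq:
  fixes \<phi> :: "'a::euclidean_space \<Rightarrow> real"
  assumes [measurable]: "\<phi> \<in> borel_measurable borel"
    and \<phi>: "integrable lborel (\<lambda>x. \<phi> x * decay p x)"
    and \<epsilon>: "0 < \<epsilon>" and p: "real DIM('a) < p" "p < real DIM('a) + 2"
  shows "integrable lborel (\<lambda>z. trunc_kernel p \<epsilon> z * (\<phi> x - \<phi> (x + z)))"
    and "trunc_lap p \<epsilon> \<phi> x =
      (\<integral>z. trunc_kernel p \<epsilon> (z::'a) \<partial>lborel) * \<phi> x - (\<integral>z. trunc_kernel p \<epsilon> (z - x) * \<phi> z \<partial>lborel)"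
proof -
  have p0: "0 \<le> p" using p by (simp add: order.trans[OF _ less_imp_le[OF p(1)]])
  have i1: "integrable lborel (\<lambda>z::'a. trunc_kernel p \<epsilon> z * \<phi> x)"
    using integrable_trunc_kernel[OF p \<epsilon>] by simp
  have i2: "integrable lborel (\<lambda>z. trunc_kernel p \<epsilon> (z - x) * \<phi> z)"
    by (rule integrable_reg_kernel_times(2)) (use \<phi> \<epsilon> p0 in auto)
  then have i3: "integrable lborel (\<lambda>z. trunc_kernel p \<epsilon> z * \<phi> (x + z))"
    using integrable_translate[of "\<lambda>z. trunc_kernel p \<epsilon> (z - x) * \<phi> z" x] by simp
  have e: "(\<integral>z. trunc_kernel p \<epsilon> z * \<phi> (x + z) \<partial>lborel) = (\<integral>z. trunc_kernel p \<epsilon> (z - x) * \<phi> z \<partial>lborel)"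
    using integral_translate[of "\<lambda>z. trunc_kernel p \<epsilon> (z - x) * \<phi> z" x] by simp
  show "integrable lborel (\<lambda>z. trunc_kernel p \<epsilon> z * (\<phi> x - \<phi> (x + z)))"
    using Bochner_Integration.integrable_diff[OF i1 i3] by (simp add: algebra_simps)
  show "trunc_lap p \<epsilon> \<phi> x =
      (\<integral>z. trunc_kernel p \<epsilon> (z::'a) \<partial>lborel) * \<phi> x - (\<integral>z. trunc_kernel p \<epsilon> (z - x) * \<phi> z \<partial>lborel)"
    unfolding trunc_lap_def using Bochner_Integration.integral_diff[OF i1 i3] e
    by (simp add: algebra_simps)
qed

text \<open>Averaging over z and -z turns first differences into second differences. First
  differences of a smooth function are of order |z|, which the kernel does not tolerate at the
  origin once p \<ge> N + 1.\<close>

lemma trunc_lap_symmetric: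
  fixes \<phi> :: "'a::euclidean_space \<Rightarrow> real"
  assumes [measurable]: "\<phi> \<in> borel_measurable borel"
    and \<phi>: "integrable lborel (\<lambda>x. \<phi> x * decay p x)"
    and \<epsilon>: "0 < \<epsilon>" and p: "real DIM('a) < p" "p < real DIM('a) + 2"
  shows "integrable lborel (\<lambda>z. trunc_kernel p \<epsilon> z * (2 * \<phi> x - \<phi> (x + z) - \<phi> (x - z)))"
    and "2 * trunc_lap p \<epsilon> \<phi> x = (\<integral>z. trunc_kernel p \<epsilon> z * (2 * \<phi> x - \<phi> (x + z) - \<phi> (x - z)) \<partial>lborel)"
proof -
  let ?F = "\<lambda>z. trunc_kernel p \<epsilon> z * (\<phi> x - \<phi> (x + z))"
  have i: "integrable lborel ?F" by (rule trunc_lap_eq(1)[OF assms])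
  have i': "integrable lborel (\<lambda>z. ?F (- z))" by (rule integrable_reflect[OF i])
  have e: "(\<integral>z. ?F (- z) \<partial>lborel) = trunc_lap p \<epsilon> \<phi> x"
    unfolding trunc_lap_def by (rule integral_reflect) simp
  have s: "(\<lambda>z. ?F z + ?F (- z)) = (\<lambda>z. trunc_kernel p \<epsilon> z * (2 * \<phi> x - \<phi> (x + z) - \<phi> (x - z)))"
    by (auto simp: fun_eq_iff trunc_kernel_minus algebra_simps)
  show "integrable lborel (\<lambda>z. trunc_kernel p \<epsilon> z * (2 * \<phi> x - \<phi> (x + z) - \<phi> (x - z)))"
    using Bochner_Integration.integrable_add[OF i i'] unfolding s .
  show "2 * trunc_lap p \<epsilon> \<phi> x = (\<integral>z. trunc_kernel p \<epsilon> z * (2 * \<phi> x - \<phi> (x + z) - \<phi> (x - z)) \<partial>lborel)"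
    using Bochner_Integration.integral_add[OF i i'] unfolding s e by (simp add: trunc_lap_def)
qed

lemma integrable_bounded_times_decay:
  fixes \<phi> :: "'a::euclidean_space \<Rightarrow> real"
  assumes p: "real DIM('a) < p" "p < real DIM('a) + 2"
    and [measurable]: "\<phi> \<in> borel_measurable borel" and "\<And>x. \<bar>\<phi> x\<bar> \<le> M"
  shows "integrable lborel (\<lambda>x. \<phi> x * decay p x)"
proof (rule Bochner_Integration.integrable_bound)
  show "integrable lborel (\<lambda>x::'a. M * decay p x)" using integrable_decay[OF p] by simp
  have "\<bar>\<phi> x\<bar> \<le> \<bar>M\<bar>" for x using assms(4)[of x] by linarith
  then show "AE x in lborel. norm (\<phi> x * decay p x) \<le> norm (M * decay p x)"
    by (intro AE_I2) (auto simp: abs_mult mult_right_mono)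
qed simp

section \<open>The Laplacian of the cutoff function\<close>

lemma bump_le_decay:
  assumes "0 < \<rho>" "0 \<le> p"
  shows "\<exists>C>0. \<forall>x. bump a \<rho> x \<le> C * decay p x"
proof -
  obtain C where C: "C > 0" "\<And>x. norm x \<le> norm a + \<rho> \<Longrightarrow> 1 \<le> C * decay p (x::'a)"
    using decay_ge_on_cball[of "norm a + \<rho>" p, where 'a = 'a] assms by auto
  have "bump a \<rho> x \<le> C * decay p x" for x
  proof (cases "norm x \<le> norm a + \<rho>")
    case True
    then show ?thesis using C(2)[of x] bump_le_1[of a \<rho> x] by linarith
  next
    case False
    then have "\<rho> \<le> norm (x - a)" using norm_triangle_sub[of x a] by linarith
    then have "bump a \<rho> x = 0" using assms by (intro bump_eq_0) auto
    then show ?thesis using C(1) decay_pos[of p x] by simp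
  qed
  then show ?thesis using C(1) by blast
qed

lemma integrable_bump_times_decay:
  fixes a :: "'a::euclidean_space"
  assumes p: "real DIM('a) < p" "p < real DIM('a) + 2"
  shows "integrable lborel (\<lambda>x. bump a \<rho> x * decay p x)"
  by (rule integrable_bounded_times_decay[OF p, where M = 1]) (auto simp: bump_nonneg bump_le_1)

text \<open>One-sided on purpose: a bound from above on the second differences at the single point x
  suffices, as semiconvexity gives, and the resulting bound is free of \<epsilon>.\<close>

lemma trunc_lap_le_second_difference:
  fixes \<phi> :: "'a::euclidean_space \<Rightarrow> real"
  assumes [measurable]: "\<phi> \<in> borel_measurable borel"
    and \<phi>: "integrable lborel (\<lambda>x. \<phi> x * decay p x)"
    and \<epsilon>: "0 < \<epsilon>" and p: "real DIM('a) < p" "p < real DIM('a) + 2"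
    and B: "0 \<le> B" and d2: "\<And>z. 2 * \<phi> x - \<phi> (x + z) - \<phi> (x - z) \<le> B * min 1 ((norm z)\<^sup>2)"
  shows "trunc_lap p \<epsilon> \<phi> x \<le> B / 2 * (\<integral>z. min 1 ((norm z)\<^sup>2) / norm (z::'a) powr p \<partial>lborel)"
proof -
  have le: "trunc_kernel p \<epsilon> z * (2 * \<phi> x - \<phi> (x + z) - \<phi> (x - z)) \<le> B * (min 1 ((norm z)\<^sup>2) / norm z powr p)" for z
  proof -
    have "trunc_kernel p \<epsilon> z * (2 * \<phi> x - \<phi> (x + z) - \<phi> (x - z)) \<le> trunc_kernel p \<epsilon> z * (B * min 1 ((norm z)\<^sup>2))"
      by (intro mult_left_mono d2 trunc_kernel_nonneg)
    also have "\<dots> \<le> 1 / norm z powr p * (B * min 1 ((norm z)\<^sup>2))"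
      using B by (intro mult_right_mono) (auto simp: trunc_kernel_def)
    finally show ?thesis by (simp add: mult_ac)
  qed
  have "2 * trunc_lap p \<epsilon> \<phi> x \<le> (\<integral>z. B * (min 1 ((norm z)\<^sup>2) / norm (z::'a) powr p) \<partial>lborel)"
    unfolding trunc_lap_symmetric(2)[OF assms(1-5)]
    by (intro integral_mono le trunc_lap_symmetric(1)[OF assms(1-5)] integrable_mult_right integrable_riesz_kernel p)
  also have "\<dots> = B * (\<integral>z. min 1 ((norm z)\<^sup>2) / norm (z::'a) powr p \<partial>lborel)"
    by (rule integral_mult_right_zero)
  finally show ?thesis by simp
qed

text \<open>The derivative \<open>2 * max 0 a\<close> of the squared positive part is Lipschitz with
  constant 2, so the first-order Taylor remainder is at most d^2.\<close>

lemma pos_part_square_taylor: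
  fixes a d :: real
  shows "\<bar>(max 0 (a + d))\<^sup>2 - (max 0 a)\<^sup>2 - 2 * max 0 a * d\<bar> \<le> d\<^sup>2"
proof -
  have 1: "a\<^sup>2 + 2 * a * d + d\<^sup>2 \<ge> 0" using zero_le_power2[of "a + d"] by (simp add: power2_sum algebra_simps)
  consider "0 \<le> a" "0 \<le> a + d" | "0 \<le> a" "a + d < 0" | "a < 0" "0 \<le> a + d" | "a < 0" "a + d < 0"
    by linarith
  then show ?thesis
  proof cases
    case 1 then show ?thesis by (simp add: power2_sum algebra_simps)
  next
    case 2
    have "a * (a + 2 * d) \<le> 0" using 2 by (intro mult_nonneg_nonpos) auto
    then show ?thesis using 2 1 by (simp add: power2_eq_square algebra_simps)
  next
    case 3
    then have "(a + d)\<^sup>2 \<le> d\<^sup>2" by (intro power_mono) auto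
    then show ?thesis using 3 by simp
  qed simp
qed

text \<open>The argument of the positive part changes by -b - c and -b + c under the shifts by h and
  -h, with b quadratic and c linear in h. The linear contributions cancel, leaving b and squares of
  the increments.\<close>

lemma bump_second_difference:
  fixes a :: "'a::euclidean_space"
  assumes \<rho>: "0 < \<rho>"
  shows "\<exists>C>0. \<forall>x h. \<bar>2 * bump a \<rho> x - bump a \<rho> (x + h) - bump a \<rho> (x - h)\<bar> \<le> C * min 1 ((norm h)\<^sup>2)"
proof (intro exI conjI allI)
  \<comment> \<open>The three summands bound \<open>4 * b\<close>, \<open>2 * b\<^sup>2\<close> and
    \<open>2 * c\<^sup>2\<close> below, each divided by |h|^2; the extra 4 in the witness covers |h|
    > 1, where all values of the cutoff lie in [0,1].\<close>
  let ?C = "4 / \<rho>\<^sup>2 + 2 / \<rho>^4 + 8 * (\<rho> + 1)\<^sup>2 / \<rho>^4"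
  show "0 < ?C + 4" using \<rho> by (intro add_nonneg_pos add_nonneg_nonneg) auto
  have C: "0 \<le> ?C" using \<rho> by (intro add_nonneg_nonneg) auto
  fix x h
  let ?D = "\<bar>2 * bump a \<rho> x - bump a \<rho> (x + h) - bump a \<rho> (x - h)\<bar>"
  show "?D \<le> (?C + 4) * min 1 ((norm h)\<^sup>2)"
  proof (cases "norm h \<le> 1")
    case False
    then have "min 1 ((norm h)\<^sup>2) = 1" by (simp add: min_def power_le_one_iff)
    moreover have "?D \<le> 4"
      using bump_nonneg[of a \<rho> x] bump_nonneg[of a \<rho> "x + h"] bump_nonneg[of a \<rho> "x - h"]
        bump_le_1[of a \<rho> x] bump_le_1[of a \<rho> "x + h"] bump_le_1[of a \<rho> "x - h"] by linarith
    ultimately show ?thesis using C by (metis add_increasing mult.right_neutral)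
  next
    case h: True
    then have m: "min 1 ((norm h)\<^sup>2) = (norm h)\<^sup>2" by (intro min_absorb2 power_le_one) auto
    show ?thesis
    proof (cases "norm (x - a) \<le> \<rho> + 1")
      case False
      have "norm (x - a) \<le> norm (x + h - a) + norm h"
        using norm_triangle_ineq4[of "x + h - a" h] by (simp add: algebra_simps)
      moreover have "norm (x - a) \<le> norm (x - h - a) + norm h"
        using norm_triangle_ineq[of "x - h - a" h] by (simp add: algebra_simps)
      ultimately have "?D = 0"
        using False h bump_eq_0[OF \<rho>, of x a] bump_eq_0[OF \<rho>, of "x + h" a] bump_eq_0[OF \<rho>, of "x - h" a]
        by simp
      moreover have "0 \<le> (?C + 4) * min 1 ((norm h)\<^sup>2)" using C by (intro mult_nonneg_nonneg) auto
      ultimately show ?thesis by linarith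
    next
      case x: True
      define A where "A = 1 - (norm (x - a))\<^sup>2 / \<rho>\<^sup>2"
      define b where "b = (norm h)\<^sup>2 / \<rho>\<^sup>2"
      define c where "c = 2 * ((x - a) \<bullet> h) / \<rho>\<^sup>2"
      have n1: "(norm (x + h - a))\<^sup>2 = (norm (x - a))\<^sup>2 + 2 * ((x - a) \<bullet> h) + (norm h)\<^sup>2"
        using dot_norm[of "x - a" h] by (simp add: algebra_simps)
      have "1 - (norm (x + h - a))\<^sup>2 / \<rho>\<^sup>2 = A + (- b - c)"
        unfolding n1 A_def b_def c_def by (simp add: add_divide_distrib)
      then have e1: "bump a \<rho> (x + h) = (max 0 (A + (- b - c)))\<^sup>2" unfolding bump_def by (simp only:)
      have n2: "(norm (x - h - a))\<^sup>2 = (norm (x - a))\<^sup>2 - 2 * ((x - a) \<bullet> h) + (norm h)\<^sup>2"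
        using dot_norm_neg[of "x - a" h] by (simp add: algebra_simps)
      have "1 - (norm (x - h - a))\<^sup>2 / \<rho>\<^sup>2 = A + (- b + c)"
        unfolding n2 A_def b_def c_def by (simp add: add_divide_distrib diff_divide_distrib)
      then have e2: "bump a \<rho> (x - h) = (max 0 (A + (- b + c)))\<^sup>2" unfolding bump_def by (simp only:)
      have e0: "bump a \<rho> x = (max 0 A)\<^sup>2" unfolding bump_def A_def ..
      have b0: "0 \<le> b" unfolding b_def by simp
      have A1: "max 0 A \<le> 1" unfolding A_def by simp
      have "?D \<le> 4 * (max 0 A * b) + (- b - c)\<^sup>2 + (- b + c)\<^sup>2"
      proof -
        \<comment> \<open>Here s1 and s2 are the linear Taylor terms
          \<open>2 * max 0 A * (- b - c)\<close> and \<open>2 * max 0 A * (- b + c)\<close>; in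
          their sum c cancels and \<open>- 4 * (max 0 A * b)\<close> remains.\<close>
        have gen: "\<bar>2 * m - q1 - q2\<bar> \<le> t + e1 + e2"
          if "\<bar>q1 - m - s1\<bar> \<le> e1" "\<bar>q2 - m - s2\<bar> \<le> e2" "s1 + s2 = - t" "0 \<le> t"
          for m q1 q2 s1 s2 t e1 e2 :: real
          using that by linarith
        show ?thesis
          unfolding e0 e1 e2
          by (rule gen[OF pos_part_square_taylor pos_part_square_taylor])
             (use b0 in \<open>auto simp: algebra_simps\<close>)
      qed
      also have "\<dots> \<le> 4 * b + 2 * b\<^sup>2 + 2 * c\<^sup>2"
        using mult_right_mono[OF A1 b0] by (simp add: power2_eq_square algebra_simps)
      also have "\<dots> \<le> 4 * ((norm h)\<^sup>2 / \<rho>\<^sup>2) + 2 * ((norm h)\<^sup>2 / \<rho>^4) + 2 * (4 * (\<rho> + 1)\<^sup>2 * (norm h)\<^sup>2 / \<rho>^4)"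
      proof -
        have "(norm h)^4 \<le> (norm h)\<^sup>2" using h by (intro power_decreasing) auto
        then have "b\<^sup>2 \<le> (norm h)\<^sup>2 / \<rho>^4"
          unfolding b_def by (simp add: power_divide divide_right_mono)
        moreover have "((x - a) \<bullet> h)\<^sup>2 \<le> ((\<rho> + 1) * norm h)\<^sup>2"
        proof (rule power2_le_iff_abs_le[THEN iffD2])
          have "\<bar>(x - a) \<bullet> h\<bar> \<le> norm (x - a) * norm h" by (rule Cauchy_Schwarz_ineq2)
          also have "\<dots> \<le> (\<rho> + 1) * norm h" using x by (intro mult_right_mono) auto
          finally show "\<bar>(x - a) \<bullet> h\<bar> \<le> (\<rho> + 1) * norm h" .
        qed (use \<rho> in auto)
        then have "c\<^sup>2 \<le> 4 * (\<rho> + 1)\<^sup>2 * (norm h)\<^sup>2 / \<rho>^4"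
          unfolding c_def by (simp add: power_divide power_mult_distrib divide_right_mono)
        ultimately show ?thesis unfolding b_def by simp
      qed
      also have "\<dots> = ?C * (norm h)\<^sup>2" by (simp add: algebra_simps)
      also have "\<dots> \<le> (?C + 4) * min 1 ((norm h)\<^sup>2)" unfolding m by (simp add: algebra_simps)
      finally show ?thesis .
    qed
  qed
qed

text \<open>On a bounded region the second differences give a constant, and a constant is a multiple
  of the weight there. Far away the cutoff vanishes, only the convolution is left, and its kernel is
  evaluated at distances at least 1. One constant serves every \<epsilon>.\<close>

lemma trunc_lap_bump_le_decay:
  fixes a :: "'a::euclidean_space"
  assumes \<rho>: "0 < \<rho>" and p: "real DIM('a) < p" "p < real DIM('a) + 2"
  shows "\<exists>C>0. \<forall>\<epsilon>>0. \<forall>x. \<bar>trunc_lap p \<epsilon> (bump a \<rho>) x\<bar> \<le> C * decay p x"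
proof -
  have p0: "0 \<le> p" using p by (simp add: order.trans[OF _ less_imp_le[OF p(1)]])
  let ?J = "\<integral>z. min 1 ((norm z)\<^sup>2) / norm (z::'a) powr p \<partial>lborel"
  let ?I = "\<integral>x. bump a \<rho> x \<partial>lborel"
  have wi: "integrable lborel (\<lambda>x. bump a \<rho> x * decay p x)" by (rule integrable_bump_times_decay[OF p])
  obtain B where B: "0 < B" and d2: "\<And>x h. \<bar>2 * bump a \<rho> x - bump a \<rho> (x + h) - bump a \<rho> (x - h)\<bar> \<le> B * min 1 ((norm h)\<^sup>2)"
    using bump_second_difference[OF \<rho>, of a] by blast
  have J: "0 \<le> ?J" by (intro integral_nonneg_AE AE_I2) simp
  have unif: "\<bar>trunc_lap p \<epsilon> (bump a \<rho>) x\<bar> \<le> B / 2 * ?J" if "0 < \<epsilon>" for \<epsilon> x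
  proof -
    have d2': "2 * bump a \<rho> x - bump a \<rho> (x + h) - bump a \<rho> (x - h) \<le> B * min 1 ((norm h)\<^sup>2)"
      "2 * - bump a \<rho> x - - bump a \<rho> (x + h) - - bump a \<rho> (x - h) \<le> B * min 1 ((norm h)\<^sup>2)" for h
      using d2[of x h] by linarith+
    have "trunc_lap p \<epsilon> (bump a \<rho>) x \<le> B / 2 * ?J"
      by (rule trunc_lap_le_second_difference[OF _ wi that p _ d2'(1)]) (use B in auto)
    moreover have "trunc_lap p \<epsilon> (\<lambda>x. - bump a \<rho> x) x \<le> B / 2 * ?J"
      by (rule trunc_lap_le_second_difference[OF _ _ that p _ d2'(2)]) (use B wi in auto)
    ultimately show ?thesis by (simp add: trunc_lap_minus)
  qed
  obtain C1 where C1: "0 < C1" "\<And>x. norm x \<le> norm a + \<rho> + 1 \<Longrightarrow> 1 \<le> C1 * decay p (x::'a)"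
    using decay_ge_on_cball[of "norm a + \<rho> + 1" p, where 'a = 'a] \<rho> p0 by auto
  obtain C2 where C2: "0 < C2" "\<And>x z. norm x \<le> norm a + \<rho> \<Longrightarrow> reg_kernel p 1 (z - x) \<le> C2 * decay p (z::'a)"
    using reg_kernel_le_decay[of 1 "norm a + \<rho>" p, where 'a = 'a] \<rho> p0 by auto
  have bi: "integrable lborel (bump a \<rho>)"
  proof -
    obtain C where "\<And>x. bump a \<rho> x \<le> C * decay p x" using bump_le_decay[OF \<rho> p0] by blast
    then have "integrable lborel (\<lambda>x. decay p x * (bump a \<rho> x / decay p x))"
      using integrable_times_decay_bound[of "\<lambda>x. 1" "bump a \<rho>" p C] integrable_decay[OF p]
      by (simp add: bump_nonneg decay_pos[THEN less_imp_neq, symmetric])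
    then show ?thesis by (simp add: decay_pos[THEN less_imp_neq, symmetric])
  qed
  have I: "0 \<le> ?I" by (intro integral_nonneg_AE AE_I2) (simp add: bump_nonneg)
  let ?C = "B / 2 * ?J * C1 + C2 * ?I"
  have main: "\<bar>trunc_lap p \<epsilon> (bump a \<rho>) x\<bar> \<le> ?C * decay p x" if \<epsilon>: "0 < \<epsilon>" for \<epsilon> x
  proof (cases "norm x \<le> norm a + \<rho> + 1")
    case True
    have "\<bar>trunc_lap p \<epsilon> (bump a \<rho>) x\<bar> \<le> B / 2 * ?J" by (rule unif[OF \<epsilon>])
    also have "\<dots> \<le> B / 2 * ?J * (C1 * decay p x)"
      using mult_left_mono[OF C1(2)[OF True], of "B / 2 * ?J"] B J by simp
    also have "\<dots> \<le> ?C * decay p x" using C2(1) I decay_pos[of p x] by (simp add: algebra_simps)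
    finally show ?thesis .
  next
    case False
    have far: "1 \<le> norm (z - x)" if "norm (z - a) < \<rho>" for z
      using that False norm_triangle_sub[of z a] norm_triangle_sub[of x z]
      by (simp add: norm_minus_commute)
    have bx: "bump a \<rho> x = 0"
      using False norm_triangle_sub[of x a] by (intro bump_eq_0[OF \<rho>]) linarith
    have le: "trunc_kernel p \<epsilon> (z - x) * bump a \<rho> z \<le> C2 * decay p x * bump a \<rho> z" for z
    proof (cases "norm (z - a) < \<rho>")
      case True
      then have "norm z \<le> norm a + \<rho>" using norm_triangle_sub[of z a] by linarith
      then have 1: "reg_kernel p 1 (x - z) \<le> C2 * decay p x" by (rule C2(2))
      \<comment> \<open>At distance at least 1 the kernel regularised at 1 is the full kernel, which
        dominates every truncation whatever \<epsilon> is.\<close>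
      have "trunc_kernel p \<epsilon> (z - x) \<le> reg_kernel p 1 (x - z)"
        using far[OF True] by (auto simp: trunc_kernel_def reg_kernel_def norm_minus_commute max_def)
      then show ?thesis using 1 by (intro mult_right_mono bump_nonneg) linarith
    next
      case False
      then show ?thesis using bump_eq_0[OF \<rho>, of z a] by simp
    qed
    have "0 \<le> (\<integral>z. trunc_kernel p \<epsilon> (z - x) * bump a \<rho> z \<partial>lborel)"
      by (intro integral_nonneg_AE AE_I2 mult_nonneg_nonneg trunc_kernel_nonneg bump_nonneg)
    moreover have "(\<integral>z. trunc_kernel p \<epsilon> (z - x) * bump a \<rho> z \<partial>lborel) \<le> (\<integral>z. C2 * decay p x * bump a \<rho> z \<partial>lborel)"
      by (intro integral_mono le integrable_mult_right bi integrable_reg_kernel_times(2) wi \<epsilon> p0 bump_measurable)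
    ultimately have "\<bar>trunc_lap p \<epsilon> (bump a \<rho>) x\<bar> \<le> C2 * decay p x * ?I"
      using trunc_lap_eq(2)[OF _ wi \<epsilon> p, of x] bx by simp
    also have "\<dots> \<le> ?C * decay p x" using C1(1) B J decay_pos[of p x] by (simp add: algebra_simps)
    finally show ?thesis .
  qed
  \<comment> \<open>The integrals in \<open>?C\<close> are only shown to be nonnegative; adding 1
    makes the constant positive.\<close>
  have "\<bar>trunc_lap p \<epsilon> (bump a \<rho>) x\<bar> \<le> (?C + 1) * decay p x" if \<epsilon>: "0 < \<epsilon>" for \<epsilon> x
  proof -
    have "?C * decay p x \<le> (?C + 1) * decay p x"
      by (rule mult_right_mono) (simp_all add: decay_pos less_imp_le)
    with main[OF \<epsilon>, of x] show ?thesis by (rule order.trans)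
  qed
  moreover have "0 < ?C + 1" using B C1(1) C2(1) I J by (intro add_nonneg_pos add_nonneg_nonneg mult_nonneg_nonneg) auto
  ultimately show ?thesis by blast
qed

text \<open>After the splitting of \<open>trunc_lap_eq\<close> the multiplication terms agree, and
  the convolution terms agree by Fubini and the symmetry of the kernel.\<close>

lemma trunc_lap_bump_duality:
  fixes v :: "'a::euclidean_space \<Rightarrow> real"
  assumes [measurable]: "v \<in> borel_measurable borel"
    and v: "integrable lborel (\<lambda>x. v x * decay p x)"
    and \<epsilon>: "0 < \<epsilon>" and p: "real DIM('a) < p" "p < real DIM('a) + 2" and \<rho>: "0 < \<rho>"
  shows "integrable lborel (\<lambda>x. bump a \<rho> x * trunc_lap p \<epsilon> v x)"
    and "(\<integral>x. bump a \<rho> x * trunc_lap p \<epsilon> v x \<partial>lborel) = (\<integral>x. v x * trunc_lap p \<epsilon> (bump a \<rho>) x \<partial>lborel)"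
proof -
  have p0: "0 \<le> p" using p by (simp add: order.trans[OF _ less_imp_le[OF p(1)]])
  let ?\<psi> = "bump a \<rho>"
  let ?K = "\<integral>z. trunc_kernel p \<epsilon> (z::'a) \<partial>lborel"
  have wi: "integrable lborel (\<lambda>x. ?\<psi> x * decay p x)" by (rule integrable_bump_times_decay[OF p])
  obtain C1 where C1: "\<And>x. \<bar>trunc_lap p \<epsilon> ?\<psi> x\<bar> \<le> C1 * decay p x"
    using trunc_lap_bump_le_decay[OF \<rho> p, of a] \<epsilon> by blast
  obtain C2 where C2: "\<And>x. ?\<psi> x \<le> C2 * decay p x" using bump_le_decay[OF \<rho> p0] by blast
  define conv where "conv z = (\<integral>x. trunc_kernel p \<epsilon> (x - z) * ?\<psi> x \<partial>lborel)" for z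
  have conv_meas [measurable]: "conv \<in> borel_measurable borel"
    unfolding conv_def by measurable
  have conv: "trunc_lap p \<epsilon> ?\<psi> z = ?K * ?\<psi> z - conv z" for z
    unfolding conv_def by (rule trunc_lap_eq(2)[OF _ wi \<epsilon> p]) simp
  have K: "0 \<le> ?K" by (intro integral_nonneg_AE AE_I2 trunc_kernel_nonneg)
  have conv0: "0 \<le> conv z" for z
    unfolding conv_def by (intro integral_nonneg_AE AE_I2 mult_nonneg_nonneg trunc_kernel_nonneg bump_nonneg)
  \<comment> \<open>The convolution is the difference of \<open>?K * ?\<psi> z\<close> and the
    truncated Laplacian, both already bounded by the weight. This bound is what makes the double
    integral absolutely convergent.\<close>
  have conv_le: "\<bar>conv z\<bar> \<le> (?K * C2 + C1) * decay p z" for z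
  proof -
    have "conv z \<le> ?K * (C2 * decay p z) + C1 * decay p z"
      using conv[of z] C1[of z] mult_left_mono[OF C2 K, of z] by linarith
    then show ?thesis using conv0[of z] by (simp add: algebra_simps)
  qed
  have tl_meas [measurable]: "trunc_lap p \<epsilon> ?\<psi> \<in> borel_measurable borel"
    unfolding conv[abs_def] by measurable
  have i_conv: "integrable lborel (\<lambda>z. v z * conv z)"
    by (rule integrable_times_decay_bound[OF _ _ v conv_le]) auto
  have i_psi: "integrable lborel (\<lambda>z. v z * ?\<psi> z)"
    by (rule integrable_times_decay_bound[OF _ _ v, where C = C2]) (auto simp: C2 bump_nonneg)
  have pair: "integrable (lborel \<Otimes>\<^sub>M lborel) (\<lambda>(z, x). v z * (trunc_kernel p \<epsilon> (x - z) * ?\<psi> x))"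
  proof (rule lborel_pair.Fubini_integrable)
    have "(\<integral>x. norm (case (z, x) of (z, x) \<Rightarrow> v z * (trunc_kernel p \<epsilon> (x - z) * ?\<psi> x)) \<partial>lborel) = \<bar>v z * conv z\<bar>" for z
      unfolding conv_def
      by (simp add: abs_mult trunc_kernel_nonneg bump_nonneg integral_nonneg_AE)
    then show "integrable lborel (\<lambda>z. \<integral>x. norm (case (z, x) of (z, x) \<Rightarrow> v z * (trunc_kernel p \<epsilon> (x - z) * ?\<psi> x)) \<partial>lborel)"
      using integrable_abs[OF i_conv] by simp
    show "AE z in lborel. integrable lborel (\<lambda>x. case (z, x) of (z, x) \<Rightarrow> v z * (trunc_kernel p \<epsilon> (x - z) * ?\<psi> x))"
      using integrable_reg_kernel_times(2)[OF _ wi \<epsilon> p0] by simp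
  qed measurable
  have fub: "(\<integral>x. \<integral>z. v z * (trunc_kernel p \<epsilon> (x - z) * ?\<psi> x) \<partial>lborel \<partial>lborel) = (\<integral>z. v z * conv z \<partial>lborel)"
    unfolding conv_def using lborel_pair.Fubini_integral[OF pair] by simp
  have in_x: "(\<integral>z. v z * (trunc_kernel p \<epsilon> (x - z) * ?\<psi> x) \<partial>lborel) = ?\<psi> x * (\<integral>z. trunc_kernel p \<epsilon> (z - x) * v z \<partial>lborel)" for x
    by (subst integral_mult_right_zero[symmetric])
       (intro Bochner_Integration.integral_cong, auto simp: trunc_kernel_commute mult_ac)
  have ix: "integrable lborel (\<lambda>x. ?\<psi> x * (\<integral>z. trunc_kernel p \<epsilon> (z - x) * v z \<partial>lborel))"
    using lborel_pair.integrable_snd[OF pair] unfolding in_x .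
  have e: "?\<psi> x * trunc_lap p \<epsilon> v x = ?K * (v x * ?\<psi> x) - ?\<psi> x * (\<integral>z. trunc_kernel p \<epsilon> (z - x) * v z \<partial>lborel)" for x
    unfolding trunc_lap_eq(2)[OF _ v \<epsilon> p, of x, simplified] by (simp add: algebra_simps)
  show "integrable lborel (\<lambda>x. ?\<psi> x * trunc_lap p \<epsilon> v x)"
    unfolding e by (intro Bochner_Integration.integrable_diff integrable_mult_right i_psi ix)
  have "(\<integral>x. ?\<psi> x * trunc_lap p \<epsilon> v x \<partial>lborel) = ?K * (\<integral>x. v x * ?\<psi> x \<partial>lborel) - (\<integral>z. v z * conv z \<partial>lborel)"
    unfolding e using i_psi ix fub in_x by simp
  also have "\<dots> = (\<integral>x. v x * trunc_lap p \<epsilon> ?\<psi> x \<partial>lborel)"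
    unfolding conv using i_psi i_conv by (simp add: right_diff_distrib mult.left_commute[of "v _" ?K])
  finally show "(\<integral>x. ?\<psi> x * trunc_lap p \<epsilon> v x \<partial>lborel) = (\<integral>x. v x * trunc_lap p \<epsilon> ?\<psi> x \<partial>lborel)" .
qed

section \<open>Sup-convolution and the weighted estimate of the Laplacian\<close>

text \<open>A Moreau envelope taken from above: adding |x|^2 / \<delta> makes it a supremum of
  functions affine in x, hence convex.\<close>

definition sup_conv :: "real \<Rightarrow> ('a::euclidean_space \<Rightarrow> real) \<Rightarrow> 'a \<Rightarrow> real" where
  "sup_conv \<delta> v x = (SUP y. v y - (norm (x - y))\<^sup>2 / \<delta>)"

context
  fixes v :: "'a::euclidean_space \<Rightarrow> real" and M \<delta> :: real
  assumes v_le: "\<And>x. \<bar>v x\<bar> \<le> M" and \<delta>: "0 < \<delta>"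
begin

lemma sup_conv_bdd: "bdd_above (range (\<lambda>y. v y - (norm (x - y))\<^sup>2 / \<delta>))"
proof (rule bdd_aboveI2)
  fix y
  have "0 \<le> (norm (x - y))\<^sup>2 / \<delta>" using \<delta> by simp
  then show "v y - (norm (x - y))\<^sup>2 / \<delta> \<le> M" using v_le[of y] by linarith
qed

lemma sup_conv_upper: "v y - (norm (x - y))\<^sup>2 / \<delta> \<le> sup_conv \<delta> v x"
  unfolding sup_conv_def by (rule cSUP_upper[OF _ sup_conv_bdd]) simp

lemma sup_conv_ge: "v x \<le> sup_conv \<delta> v x"
  using sup_conv_upper[of x x] by simp

text \<open>A supremum of continuous functions is lower semicontinuous: its strict superlevel sets
  are unions of open sets, so the uncountable index set does no harm.\<close>

lemma sup_conv_measurable: "sup_conv \<delta> v \<in> borel_measurable borel"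
  unfolding borel_measurable_iff_greater
proof
  fix c
  have "{x. c < sup_conv \<delta> v x} = (\<Union>y. {x. c < v y - (norm (x - y))\<^sup>2 / \<delta>})"
    unfolding sup_conv_def by (auto simp: less_cSUP_iff[OF _ sup_conv_bdd])
  moreover have "open {x. c < v y - (norm (x - y))\<^sup>2 / \<delta>}" for y
    unfolding divide_inverse by (intro open_Collect_less continuous_intros)
  ultimately have "open {x. c < sup_conv \<delta> v x}" by auto
  then show "{w \<in> space borel. c < sup_conv \<delta> v w} \<in> sets borel" by simp
qed

text \<open>Beyond the radius sqrt (2 M \<delta>) the penalty exceeds 2M, the largest possible gain
  in v, so x itself is a better competitor. The supremum is thus a maximum over a compact ball that
  shrinks with \<delta>.\<close>

lemma sup_conv_attained:
  assumes "continuous_on UNIV v"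
  shows "\<exists>y. sup_conv \<delta> v x = v y - (norm (x - y))\<^sup>2 / \<delta> \<and> (norm (x - y))\<^sup>2 \<le> 2 * M * \<delta>"
proof -
  let ?F = "\<lambda>y. v y - (norm (x - y))\<^sup>2 / \<delta>"
  have M: "0 \<le> M" using v_le[of x] by linarith
  let ?r = "sqrt (2 * M * \<delta>)"
  have r: "0 \<le> ?r" using M \<delta> by simp
  have "\<exists>y\<in>cball x ?r. \<forall>y'\<in>cball x ?r. ?F y' \<le> ?F y"
    unfolding divide_inverse using r
    by (intro continuous_attains_sup continuous_intros continuous_on_subset[OF assms]) auto
  then obtain y where y: "dist x y \<le> ?r" and max: "\<And>y'. dist x y' \<le> ?r \<Longrightarrow> ?F y' \<le> ?F y" by auto
  have "?F y' \<le> ?F y" for y'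
  proof (cases "dist x y' \<le> ?r")
    case False
    then have "?r\<^sup>2 \<le> (norm (x - y'))\<^sup>2" using r by (intro power_mono) (auto simp: dist_norm)
    then have "2 * M * \<delta> \<le> (norm (x - y'))\<^sup>2" using M \<delta> by simp
    then have "2 * M \<le> (norm (x - y'))\<^sup>2 / \<delta>" using \<delta> by (simp add: pos_le_divide_eq)
    then have "?F y' \<le> ?F x" using v_le[of x] v_le[of y'] by simp
    also have "\<dots> \<le> ?F y" using M \<delta> by (intro max) simp
    finally show ?thesis .
  qed (rule max)
  then have "sup_conv \<delta> v x = ?F y"
    unfolding sup_conv_def by (intro cSup_eq_maximum) auto
  moreover have "(norm (x - y))\<^sup>2 \<le> ?r\<^sup>2"
    using y by (intro power_mono) (auto simp: dist_norm)
  ultimately show ?thesis using M \<delta> by auto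
qed

lemma sup_conv_le: "sup_conv \<delta> v x \<le> M"
  unfolding sup_conv_def
proof (rule cSUP_least)
  fix y
  have "0 \<le> (norm (x - y))\<^sup>2 / \<delta>" using \<delta> by simp
  then show "v y - (norm (x - y))\<^sup>2 / \<delta> \<le> M" using v_le[of y] by linarith
qed simp

lemma sup_conv_bounded: "\<bar>sup_conv \<delta> v x\<bar> \<le> M"
  using sup_conv_le[of x] sup_conv_ge[of x] v_le[of x] by linarith

text \<open>The maximiser y for x is a competitor at x + z and x - z, and the parallelogram law
  reduces the penalties to 2 |z|^2 / \<delta>. For |z| > 1 boundedness by M is enough.\<close>

lemma sup_conv_semiconvex:
  assumes "continuous_on UNIV v"
  shows "2 * sup_conv \<delta> v x - sup_conv \<delta> v (x + z) - sup_conv \<delta> v (x - z)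
    \<le> (4 * M + 2 / \<delta>) * min 1 ((norm z)\<^sup>2)"
proof -
  let ?D = "2 * sup_conv \<delta> v x - sup_conv \<delta> v (x + z) - sup_conv \<delta> v (x - z)"
  have M: "0 \<le> M" using v_le[of x] by linarith
  obtain y where y: "sup_conv \<delta> v x = v y - (norm (x - y))\<^sup>2 / \<delta>"
    using sup_conv_attained[OF assms] by blast
  have par: "(norm (x + z - y))\<^sup>2 + (norm (x - z - y))\<^sup>2 = 2 * (norm (x - y))\<^sup>2 + 2 * (norm z)\<^sup>2"
    unfolding power2_norm_eq_inner by (simp add: inner_simps inner_commute algebra_simps)
  have "?D \<le> ((norm (x + z - y))\<^sup>2 + (norm (x - z - y))\<^sup>2) / \<delta> - 2 * (norm (x - y))\<^sup>2 / \<delta>"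
    using y sup_conv_upper[of y "x + z"] sup_conv_upper[of y "x - z"]
    by (simp add: add_divide_distrib)
  also have "\<dots> = 2 / \<delta> * (norm z)\<^sup>2" unfolding par by (simp add: add_divide_distrib)
  finally have D1: "?D \<le> 2 / \<delta> * (norm z)\<^sup>2" .
  have D2: "?D \<le> 4 * M"
    using sup_conv_bounded[of x] sup_conv_bounded[of "x + z"] sup_conv_bounded[of "x - z"] by linarith
  show ?thesis
  proof (cases "(norm z)\<^sup>2 \<le> 1")
    case True
    have "?D \<le> 2 / \<delta> * (norm z)\<^sup>2" by (rule D1)
    also have "\<dots> \<le> (4 * M + 2 / \<delta>) * (norm z)\<^sup>2" using M by (intro mult_right_mono) auto
    finally show ?thesis using True by (simp add: min_absorb2)
  next
    case False
    have "0 \<le> 2 / \<delta>" using \<delta> by simp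
    then have "?D \<le> 4 * M + 2 / \<delta>" using D2 by linarith
    then show ?thesis using False by (simp add: min_absorb1)
  qed
qed

end

text \<open>The truncations converge only pointwise, without any uniformity in \<open>x\<close>, so they cannot be
  integrated against \<open>bump\<close> term by term. The sup-convolution \<open>V\<close> of \<open>v\<close> touches a translate of
  \<open>v\<close> from above, which transfers the pointwise information from \<open>v\<close> to \<open>V\<close>, and it is semiconvex,
  which bounds its truncations from above; this suffices for the reverse Fatou lemma.\<close>

lemma bump_lap_lower_bound:
  fixes v h :: "'a::euclidean_space \<Rightarrow> real"
  assumes p: "real DIM('a) < p" "p < real DIM('a) + 2" and \<rho>: "0 < \<rho>" and c: "0 \<le> c"
    and vM: "\<And>x. \<bar>v x\<bar> \<le> M" and v_uc: "uniformly_continuous_on UNIV v"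
    and h: "continuous_on UNIV h"
    and lap: "\<And>x. norm (x - a) < \<rho> + 1 \<Longrightarrow> ((\<lambda>\<epsilon>. c * trunc_lap p \<epsilon> v x) \<longlongrightarrow> h x) (at_right 0)"
    and C0: "0 \<le> C" and C: "\<And>\<epsilon> x. 0 < \<epsilon> \<Longrightarrow> \<bar>trunc_lap p \<epsilon> (bump a \<rho>) x\<bar> \<le> C * decay p x"
  shows "- (c * C * (\<integral>x. \<bar>v x\<bar> * decay p x \<partial>lborel)) \<le> (\<integral>x. bump a \<rho> x * h x \<partial>lborel)"
proof -
  let ?\<psi> = "bump a \<rho>"
  let ?v = "\<integral>x. \<bar>v x\<bar> * decay p x \<partial>lborel"
  let ?W = "\<integral>x. decay p (x::'a) \<partial>lborel"
  let ?I = "\<integral>x. ?\<psi> x \<partial>lborel"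
  let ?H = "\<integral>x. ?\<psi> x * h x \<partial>lborel"
  have v_cont: "continuous_on UNIV v" by (rule uniformly_continuous_imp_continuous[OF v_uc])
  then have [measurable]: "v \<in> borel_measurable borel" by (rule borel_measurable_continuous_onI)
  have M0: "0 \<le> M" using vM[of a] by linarith
  have psi_int: "integrable lborel ?\<psi>"
    using integrable_bump_times_continuous[OF \<rho>, of "\<lambda>x. 1" a] by simp
  have h_int: "integrable lborel (\<lambda>x. ?\<psi> x * h x)" by (rule integrable_bump_times_continuous[OF \<rho> h])
  have v_int: "integrable lborel (\<lambda>x. \<bar>v x\<bar> * decay p x)"
    by (rule integrable_bounded_times_decay[OF p, where M = M]) (auto simp: vM)
  have W: "0 \<le> ?W" by (intro integral_nonneg_AE AE_I2) (simp add: decay_pos less_imp_le)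
  have I: "0 \<le> ?I" by (intro integral_nonneg_AE AE_I2) (simp add: bump_nonneg)
  \<comment> \<open>The tolerance \<eta> fixes \<delta> and with it V; the majorant \<open>B\<close>
    contains 2/\<delta>, but the final inequality does not, so \<eta> can tend to 0 at the
    end.\<close>
  have approx: "- (c * C * (?v + \<eta> * ?W)) \<le> ?H + \<eta> * ?I" if \<eta>: "0 < \<eta>" for \<eta>
  proof -
    obtain d1 where d1: "0 < d1" "\<And>x y. norm (x - y) < d1 \<Longrightarrow> \<bar>v y - v x\<bar> < \<eta>"
      using v_uc \<eta> unfolding uniformly_continuous_on_def dist_norm real_norm_def
      by (metis UNIV_I norm_minus_commute abs_minus_commute)
    have "uniformly_continuous_on (cball a (\<rho> + 1)) h"
      by (intro compact_uniformly_continuous continuous_on_subset[OF h]) auto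
    then obtain d2 where d2: "0 < d2"
      "\<And>x y. x \<in> cball a (\<rho> + 1) \<Longrightarrow> y \<in> cball a (\<rho> + 1) \<Longrightarrow> norm (x - y) < d2 \<Longrightarrow> \<bar>h y - h x\<bar> < \<eta>"
      using \<eta> unfolding uniformly_continuous_on_def dist_norm real_norm_def
      by (metis norm_minus_commute abs_minus_commute)
    \<comment> \<open>The contact point y must stay in the ball of radius \<rho> + 1, where
      \<open>lap\<close> is available, and v and h must vary by less than \<eta> between x and
      y.\<close>
    define r where "r = min 1 (min d1 d2)"
    have r: "0 < r" "r \<le> 1" "r \<le> d1" "r \<le> d2" using d1 d2 unfolding r_def by auto
    \<comment> \<open>The 1 in the denominator makes the contact distance strictly smaller than r
      and covers M = 0.\<close>
    define \<delta> where "\<delta> = r\<^sup>2 / (2 * M + 1)"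
    have \<delta>: "0 < \<delta>" unfolding \<delta>_def using r M0 by simp
    have \<delta>_less: "2 * M * \<delta> < r\<^sup>2"
      unfolding \<delta>_def using r M0 by (simp add: field_simps)
    define V where "V = sup_conv \<delta> v"
    have V_meas [measurable]: "V \<in> borel_measurable borel"
      unfolding V_def by (rule sup_conv_measurable[OF vM \<delta>])
    have V_upper: "v y - (norm (x - y))\<^sup>2 / \<delta> \<le> V x" for x y
      unfolding V_def by (rule sup_conv_upper[OF vM \<delta>])
    have VM: "\<bar>V x\<bar> \<le> M" for x unfolding V_def by (rule sup_conv_bounded[OF vM \<delta>])
    have touch: "\<exists>y. V x = v y - (norm (x - y))\<^sup>2 / \<delta> \<and> norm (x - y) < r" for x
    proof -
      obtain y where "V x = v y - (norm (x - y))\<^sup>2 / \<delta>" "(norm (x - y))\<^sup>2 \<le> 2 * M * \<delta>"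
        using sup_conv_attained[OF vM \<delta> v_cont] unfolding V_def by blast
      then show ?thesis using \<delta>_less r(1) power2_less_imp_less[of "norm (x - y)" r] by force
    qed
    have V_near: "\<bar>V x\<bar> \<le> \<bar>v x\<bar> + \<eta>" for x
    proof -
      obtain y where y: "V x = v y - (norm (x - y))\<^sup>2 / \<delta>" "norm (x - y) < r" using touch by blast
      have "0 \<le> (norm (x - y))\<^sup>2 / \<delta>" using \<delta> by simp
      moreover have "\<bar>v y - v x\<bar> < \<eta>" using y r by (intro d1(2)) simp
      ultimately show ?thesis using y(1) V_upper[of x x] by simp
    qed
    have V_int: "integrable lborel (\<lambda>x. V x * decay p x)"
      by (rule integrable_bounded_times_decay[OF p _ VM]) simp
    define B where "B = (4 * M + 2 / \<delta>) / 2 * (\<integral>z. min 1 ((norm z)\<^sup>2) / norm (z::'a) powr p \<partial>lborel)"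
    have V_le_B: "trunc_lap p \<epsilon> V x \<le> B" if "0 < \<epsilon>" for \<epsilon> x
      unfolding B_def
    proof (rule trunc_lap_le_second_difference[OF V_meas V_int that p])
      show "0 \<le> 4 * M + 2 / \<delta>" using M0 \<delta> by simp
      show "2 * V x - V (x + z) - V (x - z) \<le> (4 * M + 2 / \<delta>) * min 1 ((norm z)\<^sup>2)" for z
        unfolding V_def by (rule sup_conv_semiconvex[OF vM \<delta> v_cont])
    qed
    have v_wint: "integrable lborel (\<lambda>x. v x * decay p x)"
      by (rule integrable_bounded_times_decay[OF p _ vM]) simp
    \<comment> \<open>Shifting x and its contact point y by the same z leaves the penalty unchanged,
      so V (x + z) is at least v (y + z) minus that penalty, with equality at z = 0.\<close>
    have compare: "trunc_lap p \<epsilon> V x \<le> trunc_lap p \<epsilon> v y"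
      if "0 < \<epsilon>" "V x = v y - (norm (x - y))\<^sup>2 / \<delta>" for \<epsilon> x y
      unfolding trunc_lap_def
    proof (intro integral_mono mult_left_mono trunc_kernel_nonneg)
      show "integrable lborel (\<lambda>z. trunc_kernel p \<epsilon> z * (V x - V (x + z)))"
        by (rule trunc_lap_eq(1)[OF V_meas V_int that(1) p])
      show "integrable lborel (\<lambda>z. trunc_kernel p \<epsilon> z * (v y - v (y + z)))"
        by (rule trunc_lap_eq(1)[OF _ v_wint that(1) p]) simp
      show "V x - V (x + z) \<le> v y - v (y + z)" for z
        using V_upper[of "y + z" "x + z"] that(2) by simp
    qed
    define e where "e n = 1 / real (Suc n)" for n
    have e0: "0 < e n" for n unfolding e_def by simp
    have e_lim: "filterlim e (at_right 0) sequentially"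
      unfolding filterlim_at e_def using LIMSEQ_inverse_real_of_nat by (auto simp: inverse_eq_divide)
    define F where "F n x = ?\<psi> x * (c * trunc_lap p (e n) V x)" for n x
    define g where "g x = ?\<psi> x * (h x + \<eta>)" for x
    have F_int: "integrable lborel (F n)" for n
      using integrable_mult_right[OF trunc_lap_bump_duality(1)[OF V_meas V_int e0 p \<rho>], of c a n]
      unfolding F_def by (simp add: mult.left_commute)
    have g_int: "integrable lborel g" unfolding g_def distrib_left using h_int psi_int by simp
    have F_le: "F n x \<le> c * B * ?\<psi> x" for n x
    proof -
      have "F n x \<le> ?\<psi> x * (c * B)"
        unfolding F_def by (intro mult_left_mono V_le_B e0 c bump_nonneg)
      then show ?thesis by (simp add: mult_ac)
    qed
    \<comment> \<open>Only an upper bound g x on the limsup of \<open>F n x\<close> is known, since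
      the truncations at the contact point converge to h y \<le> h x + \<eta>. Taking the maximum
      with g turns this into convergence and adds a bound from below, so dominated convergence acts
      as the reverse Fatou lemma.\<close>
    have lim: "(\<lambda>n. max (F n x) (g x)) \<longlonglongrightarrow> g x" for x
    proof (cases "?\<psi> x = 0")
      case False
      then have x: "norm (x - a) < \<rho>" using bump_eq_0[OF \<rho>, of x a] by linarith
      obtain y where y: "V x = v y - (norm (x - y))\<^sup>2 / \<delta>" "norm (x - y) < r" using touch by blast
      have ya: "norm (y - a) < \<rho> + 1"
        using x y(2) r(2) norm_triangle_ineq[of "x - a" "y - x"] by (simp add: norm_minus_commute)
      have "h y \<le> h x + \<eta>"
        using d2(2)[of x y] x y(2) ya r(4) by (auto simp: dist_norm norm_minus_commute)
      then have le: "?\<psi> x * h y \<le> g x" unfolding g_def by (intro mult_left_mono bump_nonneg)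
      have "(\<lambda>n. c * trunc_lap p (e n) v y) \<longlonglongrightarrow> h y"
        by (rule filterlim_compose[OF lap[OF ya] e_lim])
      then have "(\<lambda>n. max (?\<psi> x * (c * trunc_lap p (e n) v y)) (g x)) \<longlonglongrightarrow> max (?\<psi> x * h y) (g x)"
        by (intro tendsto_max tendsto_intros)
      then have up: "(\<lambda>n. max (?\<psi> x * (c * trunc_lap p (e n) v y)) (g x)) \<longlonglongrightarrow> g x"
        using le by (simp add: max_absorb2)
      have "F n x \<le> ?\<psi> x * (c * trunc_lap p (e n) v y)" for n
        unfolding F_def by (intro mult_left_mono compare e0 y(1) c bump_nonneg)
      then show ?thesis
        by (intro tendsto_sandwich[OF _ _ tendsto_const up] always_eventually allI max.mono) simp_all
    qed (simp add: F_def g_def)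
    have dom: "norm (max (F n x) (g x)) \<le> \<bar>c * B\<bar> * ?\<psi> x + \<bar>g x\<bar>" for n x
    proof -
      have "c * B * ?\<psi> x \<le> \<bar>c * B\<bar> * ?\<psi> x" by (intro mult_right_mono bump_nonneg) simp
      moreover have "0 \<le> \<bar>c * B\<bar> * ?\<psi> x" by (intro mult_nonneg_nonneg bump_nonneg) simp
      ultimately show ?thesis using F_le[of n x] by (simp add: max_def) linarith
    qed
    have G_lim: "(\<lambda>n. \<integral>x. max (F n x) (g x) \<partial>lborel) \<longlonglongrightarrow> (\<integral>x. g x \<partial>lborel)"
    proof (rule integral_dominated_convergence)
      show "integrable lborel (\<lambda>x. \<bar>c * B\<bar> * ?\<psi> x + \<bar>g x\<bar>)" using psi_int g_int by simp
      show "AE x in lborel. norm (max (F n x) (g x)) \<le> \<bar>c * B\<bar> * ?\<psi> x + \<bar>g x\<bar>" for n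
        by (rule AE_I2) (rule dom)
      show "(\<lambda>x. max (F n x) (g x)) \<in> borel_measurable lborel" for n
        using F_int[of n] g_int by (intro borel_measurable_max) auto
    qed (use lim g_int in auto)
    \<comment> \<open>Duality puts the truncation on the cutoff, where the bound \<open>C\<close> is
      independent of n.\<close>
    have lower: "- (c * C * (?v + \<eta> * ?W)) \<le> (\<integral>x. max (F n x) (g x) \<partial>lborel)" for n
    proof -
      have "\<bar>\<integral>x. V x * trunc_lap p (e n) ?\<psi> x \<partial>lborel\<bar> \<le> (\<integral>x. C * (\<bar>v x\<bar> * decay p x + \<eta> * decay p x) \<partial>lborel)"
      proof (rule order.trans[OF integral_abs_bound], rule integral_mono')
        show "integrable lborel (\<lambda>x. C * (\<bar>v x\<bar> * decay p x + \<eta> * decay p x))"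
          using v_int integrable_decay[OF p] by simp
        show "\<bar>V x * trunc_lap p (e n) ?\<psi> x\<bar> \<le> C * (\<bar>v x\<bar> * decay p x + \<eta> * decay p x)" for x
        proof -
          have "\<bar>V x\<bar> * \<bar>trunc_lap p (e n) ?\<psi> x\<bar> \<le> (\<bar>v x\<bar> + \<eta>) * (C * decay p x)"
            using \<eta> by (intro mult_mono V_near C e0) auto
          then show ?thesis by (simp add: abs_mult algebra_simps)
        qed
        show "0 \<le> C * (\<bar>v x\<bar> * decay p x + \<eta> * decay p x)" for x
          using C0 \<eta> by (intro mult_nonneg_nonneg add_nonneg_nonneg) (simp_all add: decay_pos less_imp_le)
      qed
      also have "\<dots> = C * (?v + \<eta> * ?W)"
        using v_int integrable_decay[OF p] by simp
      finally have "- (C * (?v + \<eta> * ?W)) \<le> (\<integral>x. V x * trunc_lap p (e n) ?\<psi> x \<partial>lborel)" by linarith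
      then have "c * - (C * (?v + \<eta> * ?W)) \<le> c * (\<integral>x. ?\<psi> x * trunc_lap p (e n) V x \<partial>lborel)"
        unfolding trunc_lap_bump_duality(2)[OF V_meas V_int e0 p \<rho>] by (rule mult_left_mono[OF _ c])
      also have "\<dots> = (\<integral>x. F n x \<partial>lborel)"
        unfolding F_def by (simp add: mult.left_commute[of _ c])
      also have "\<dots> \<le> (\<integral>x. max (F n x) (g x) \<partial>lborel)"
        using F_int g_int by (intro integral_mono) auto
      finally show ?thesis by (simp add: mult_ac)
    qed
    have "- (c * C * (?v + \<eta> * ?W)) \<le> (\<integral>x. g x \<partial>lborel)"
      by (rule LIMSEQ_le_const[OF G_lim]) (use lower in auto)
    also have "\<dots> = ?H + \<eta> * ?I"
      unfolding g_def distrib_left using h_int psi_int by (simp add: mult.commute[of \<eta>])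
    finally show ?thesis .
  qed
  show ?thesis
  proof (rule field_le_epsilon)
    fix e :: real assume e: "0 < e"
    let ?K = "c * C * ?W + ?I"
    have K: "0 \<le> ?K" using c C0 W I by simp
    \<comment> \<open>\<open>?K\<close> may be 0.\<close>
    define \<eta> where "\<eta> = e / (?K + 1)"
    have \<eta>: "0 < \<eta>" "\<eta> * ?K \<le> e" unfolding \<eta>_def using e K by (auto simp: field_simps)
    show "- (c * C * ?v) \<le> ?H + e" using approx[OF \<eta>(1)] \<eta>(2) by (simp add: algebra_simps)
  qed
qed

text \<open>Near the support of \<open>bump\<close> the part \<open>u2\<close> of \<open>\<phi>\<close> away from it has a continuous Laplacian,
  given by a nonsingular integral, so only the compactly supported part \<open>u1\<close> needs
  the sup-convolution.\<close>

lemma bump_lap_bound: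
  fixes a :: "'a::euclidean_space"
  assumes p: "real DIM('a) < p" "p < real DIM('a) + 2" and \<rho>: "0 < \<rho>" and c: "0 \<le> c"
  shows "\<exists>K\<ge>0. \<forall>\<phi> h. continuous_on UNIV \<phi> \<longrightarrow> integrable lborel (\<lambda>x. \<phi> x * decay p x) \<longrightarrow>
    continuous_on UNIV h \<longrightarrow> (\<forall>x. ((\<lambda>\<epsilon>. c * trunc_lap p \<epsilon> \<phi> x) \<longlongrightarrow> h x) (at_right 0)) \<longrightarrow>
    \<bar>\<integral>x. bump a \<rho> x * h x \<partial>lborel\<bar> \<le> K * (\<integral>x. \<bar>\<phi> x\<bar> * decay p x \<partial>lborel)"
proof -
  have p0: "0 \<le> p" using p by (simp add: order.trans[OF _ less_imp_le[OF p(1)]])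
  obtain C where C: "0 < C" "\<And>\<epsilon> x. 0 < \<epsilon> \<Longrightarrow> \<bar>trunc_lap p \<epsilon> (bump a \<rho>) x\<bar> \<le> C * decay p x"
    using trunc_lap_bump_le_decay[OF \<rho> p, of a] by blast
  show ?thesis
  \<comment> \<open>One contribution \<open>c * C\<close> for each of the two parts of \<phi>. The
    constant is fixed before \<phi> and h, so it is the same for all times.\<close>
  proof (intro exI[of _ "2 * (c * C)"] conjI allI impI)
    show "0 \<le> 2 * (c * C)" using c C by simp
    fix \<phi> h :: "'a \<Rightarrow> real"
    assume \<phi>: "continuous_on UNIV \<phi>" and \<phi>_int: "integrable lborel (\<lambda>x. \<phi> x * decay p x)"
      and h: "continuous_on UNIV h"
      and lap: "\<forall>x. ((\<lambda>\<epsilon>. c * trunc_lap p \<epsilon> \<phi> x) \<longlongrightarrow> h x) (at_right 0)"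
    let ?N = "\<integral>x. \<bar>\<phi> x\<bar> * decay p x \<partial>lborel"
    \<comment> \<open>Equal to 1 up to radius \<rho> + 2 and to 0 from radius \<rho> + 3 on: points
      within \<rho> + 1 of a then have the whole closed unit ball around them free of
      \<open>u2\<close>.\<close>
    define \<kappa> where "\<kappa> x = max 0 (min 1 (\<rho> + 3 - norm (x - a)))" for x
    define u1 where "u1 x = \<kappa> x * \<phi> x" for x
    define u2 where "u2 x = (1 - \<kappa> x) * \<phi> x" for x
    have \<kappa>: "0 \<le> \<kappa> x" "\<kappa> x \<le> 1" for x unfolding \<kappa>_def by auto
    have \<kappa>_cont: "continuous_on UNIV \<kappa>" unfolding \<kappa>_def by (intro continuous_intros)
    have u1_cont: "continuous_on UNIV u1" unfolding u1_def by (intro continuous_intros \<kappa>_cont \<phi>)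
    have u2_cont: "continuous_on UNIV u2" unfolding u2_def by (intro continuous_intros \<kappa>_cont \<phi>)
    have [measurable]: "u1 \<in> borel_measurable borel" "u2 \<in> borel_measurable borel" "\<phi> \<in> borel_measurable borel"
      by (intro borel_measurable_continuous_onI u1_cont u2_cont \<phi>)+
    have u_le: "\<bar>u1 x\<bar> \<le> \<bar>\<phi> x\<bar>" "\<bar>u2 x\<bar> \<le> \<bar>\<phi> x\<bar>" for x
      unfolding u1_def u2_def using \<kappa>[of x] by (simp_all add: abs_mult mult_left_le_one_le)
    have wint: "integrable lborel (\<lambda>x. v x * decay p x)"
      "(\<integral>x. \<bar>v x\<bar> * decay p x \<partial>lborel) \<le> ?N"
      if [measurable]: "v \<in> borel_measurable borel" and le: "\<And>x. \<bar>v x\<bar> \<le> \<bar>\<phi> x\<bar>" for v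
    proof -
      have le': "\<bar>v x\<bar> * decay p x \<le> \<bar>\<phi> x\<bar> * decay p x" for x
        by (intro mult_right_mono le) (simp add: decay_pos less_imp_le)
      show i: "integrable lborel (\<lambda>x. v x * decay p x)"
        by (rule Bochner_Integration.integrable_bound[OF \<phi>_int])
           (use le' in \<open>auto simp: abs_mult decay_pos less_imp_le\<close>)
      show "(\<integral>x. \<bar>v x\<bar> * decay p x \<partial>lborel) \<le> ?N"
        by (intro integral_mono le' integrable_abs_times_decay i \<phi>_int)
    qed
    have u1_int: "integrable lborel (\<lambda>x. u1 x * decay p x)" and u1_N: "(\<integral>x. \<bar>u1 x\<bar> * decay p x \<partial>lborel) \<le> ?N"
      by (rule wint; simp add: u_le)+
    have u2_int: "integrable lborel (\<lambda>x. u2 x * decay p x)" and u2_N: "(\<integral>x. \<bar>u2 x\<bar> * decay p x \<partial>lborel) \<le> ?N"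
      by (rule wint; simp add: u_le)+
    have u2_0: "u2 z = 0" if "norm (x - a) < \<rho> + 1" "norm (z - x) \<le> 1" for x z
    proof -
      have "norm (z - a) \<le> \<rho> + 2" using that norm_triangle_ineq[of "z - x" "x - a"] by simp
      then show ?thesis unfolding u2_def \<kappa>_def by simp
    qed
    \<comment> \<open>For x near the support of the cutoff, \<open>u2\<close> vanishes wherever the
      kernels differ, so every truncation with \<epsilon> \<le> 1 already gives this value; the
      regularised kernel makes it continuous in x.\<close>
    define h2 where "h2 x = - (c * (\<integral>z. reg_kernel p 1 (z - x) * u2 z \<partial>lborel))" for x
    have h2_cont: "continuous_on UNIV h2"
      unfolding h2_def
      by (intro continuous_intros continuous_on_reg_kernel_convolution u2_int p0) auto
    have h2: "c * trunc_lap p \<epsilon> u2 x = h2 x" if "norm (x - a) < \<rho> + 1" "0 < \<epsilon>" "\<epsilon> \<le> 1" for \<epsilon> x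
    proof -
      have "trunc_kernel p \<epsilon> (z - x) * u2 z = reg_kernel p 1 (z - x) * u2 z" for z
      proof (cases "norm (z - x) \<le> 1")
        case False
        then show ?thesis using that(3) by (simp add: trunc_kernel_def reg_kernel_def max_def)
      qed (use u2_0[OF that(1)] in simp)
      then have eq: "(\<lambda>z. trunc_kernel p \<epsilon> (z - x) * u2 z) = (\<lambda>z. reg_kernel p 1 (z - x) * u2 z)" ..
      have "u2 x = 0" using u2_0[OF that(1), of x] by simp
      then show ?thesis
        unfolding h2_def trunc_lap_eq(2)[OF _ u2_int that(2) p, of x, simplified] eq by simp
    qed
    define h1 where "h1 x = h x - h2 x" for x
    have h1_cont: "continuous_on UNIV h1" unfolding h1_def by (intro continuous_intros h h2_cont)
    have lap1: "((\<lambda>\<epsilon>. c * trunc_lap p \<epsilon> u1 x) \<longlongrightarrow> h1 x) (at_right 0)" if x: "norm (x - a) < \<rho> + 1" for x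
    proof (rule Lim_transform_eventually)
      show "((\<lambda>\<epsilon>. c * trunc_lap p \<epsilon> \<phi> x - h2 x) \<longlongrightarrow> h1 x) (at_right 0)"
        unfolding h1_def using lap by (intro tendsto_intros) auto
      have "c * trunc_lap p \<epsilon> \<phi> x - h2 x = c * trunc_lap p \<epsilon> u1 x" if "0 < \<epsilon>" "\<epsilon> < 1" for \<epsilon>
      proof -
        have "trunc_lap p \<epsilon> \<phi> x = trunc_lap p \<epsilon> u1 x + trunc_lap p \<epsilon> u2 x"
        proof -
          have "(\<lambda>z. trunc_kernel p \<epsilon> z * (\<phi> x - \<phi> (x + z))) =
            (\<lambda>z. trunc_kernel p \<epsilon> z * (u1 x - u1 (x + z)) + trunc_kernel p \<epsilon> z * (u2 x - u2 (x + z)))"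
            unfolding u1_def u2_def by (auto simp: algebra_simps)
          then show ?thesis
            unfolding trunc_lap_def
            using trunc_lap_eq(1)[OF _ u1_int that(1) p] trunc_lap_eq(1)[OF _ u2_int that(1) p] by simp
        qed
        then show ?thesis using h2[OF x that(1)] that(2) by (simp add: algebra_simps)
      qed
      then show "\<forall>\<^sub>F \<epsilon> in at_right 0. c * trunc_lap p \<epsilon> \<phi> x - h2 x = c * trunc_lap p \<epsilon> u1 x"
        unfolding eventually_at_right_field by (intro exI[of _ 1]) auto
    qed
    have u1_supp: "u1 x = 0" if "\<rho> + 3 \<le> norm (x - a)" for x
      using that unfolding u1_def \<kappa>_def by simp
    note u1_uc = compact_support_uniformly_continuous(1)[OF u1_cont u1_supp]
    obtain M where M: "\<And>x. \<bar>u1 x\<bar> \<le> M"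
      using compact_support_uniformly_continuous(2)[OF u1_cont u1_supp] by blast
    have b1: "\<bar>\<integral>x. bump a \<rho> x * h1 x \<partial>lborel\<bar> \<le> c * C * ?N"
    proof -
      have "- (c * C * (\<integral>x. \<bar>u1 x\<bar> * decay p x \<partial>lborel)) \<le> (\<integral>x. bump a \<rho> x * h1 x \<partial>lborel)"
        by (rule bump_lap_lower_bound[OF p \<rho> c M u1_uc h1_cont lap1 less_imp_le[OF C(1)] C(2)])
      moreover have "- (c * C * (\<integral>x. \<bar>- u1 x\<bar> * decay p x \<partial>lborel)) \<le> (\<integral>x. bump a \<rho> x * - h1 x \<partial>lborel)"
      proof (rule bump_lap_lower_bound[OF p \<rho> c _ _ _ _ less_imp_le[OF C(1)] C(2)])
        show "uniformly_continuous_on UNIV (\<lambda>x. - u1 x)" by (rule uniformly_continuous_on_minus[OF u1_uc])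
        show "((\<lambda>\<epsilon>. c * trunc_lap p \<epsilon> (\<lambda>x. - u1 x) x) \<longlongrightarrow> - h1 x) (at_right 0)" if "norm (x - a) < \<rho> + 1" for x
          using tendsto_minus[OF lap1[OF that]] by (simp add: trunc_lap_minus)
      qed (use M in \<open>auto intro!: continuous_intros h1_cont\<close>)
      moreover have "c * C * (\<integral>x. \<bar>u1 x\<bar> * decay p x \<partial>lborel) \<le> c * C * ?N"
        using c C(1) by (intro mult_left_mono u1_N) auto
      ultimately show ?thesis by simp
    qed
    have b2: "\<bar>\<integral>x. bump a \<rho> x * h2 x \<partial>lborel\<bar> \<le> c * C * ?N"
    proof -
      have "bump a \<rho> x * h2 x = c * (bump a \<rho> x * trunc_lap p 1 u2 x)" for x
        using h2[of x 1] bump_eq_0[OF \<rho>, of x a] by (cases "norm (x - a) < \<rho> + 1") auto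
      then have "(\<lambda>x. bump a \<rho> x * h2 x) = (\<lambda>x. c * (bump a \<rho> x * trunc_lap p 1 u2 x))" ..
      then have eq: "(\<integral>x. bump a \<rho> x * h2 x \<partial>lborel) = c * (\<integral>x. u2 x * trunc_lap p 1 (bump a \<rho>) x \<partial>lborel)"
        using trunc_lap_bump_duality(2)[OF _ u2_int _ p \<rho>, of 1 a] by simp
      have "\<bar>\<integral>x. u2 x * trunc_lap p 1 (bump a \<rho>) x \<partial>lborel\<bar> \<le> (\<integral>x. C * (\<bar>u2 x\<bar> * decay p x) \<partial>lborel)"
      proof (rule order.trans[OF integral_abs_bound], rule integral_mono')
        show "integrable lborel (\<lambda>x. C * (\<bar>u2 x\<bar> * decay p x))"
          by (intro integrable_mult_right integrable_abs_times_decay u2_int)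
        show "\<bar>u2 x * trunc_lap p 1 (bump a \<rho>) x\<bar> \<le> C * (\<bar>u2 x\<bar> * decay p x)" for x
          using mult_left_mono[OF C(2)[of 1 x], of "\<bar>u2 x\<bar>"] by (simp add: abs_mult mult_ac)
        show "0 \<le> C * (\<bar>u2 x\<bar> * decay p x)" for x
          using C(1) by (simp add: decay_pos less_imp_le)
      qed
      moreover have "\<dots> \<le> C * ?N" using C(1) u2_N by simp
      ultimately have "\<bar>\<integral>x. u2 x * trunc_lap p 1 (bump a \<rho>) x \<partial>lborel\<bar> \<le> C * ?N" by linarith
      from mult_left_mono[OF this c] show ?thesis using c eq by (simp add: abs_mult mult.assoc)
    qed
    have "(\<integral>x. bump a \<rho> x * h x \<partial>lborel) = (\<integral>x. bump a \<rho> x * h1 x \<partial>lborel) + (\<integral>x. bump a \<rho> x * h2 x \<partial>lborel)"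
      using Bochner_Integration.integral_add[OF integrable_bump_times_continuous[OF \<rho> h1_cont] integrable_bump_times_continuous[OF \<rho> h2_cont], of a a]
      unfolding h1_def by (simp add: algebra_simps)
    then show "\<bar>\<integral>x. bump a \<rho> x * h x \<partial>lborel\<bar> \<le> 2 * (c * C) * ?N" using b1 b2 by simp
  qed
qed

section \<open>The balance of mass\<close>

text \<open>Integrating X' = - A - G over [a,b] leaves the integral of A as the error, and this is
  at most a constant times the finite integral of the weighted norm over (0,T), whatever a and b
  are.\<close>

lemma bump_mass_balance:
  fixes u :: "real \<Rightarrow> real^'n \<Rightarrow> real"
  assumes s: "0 < s" "s < 1"
    and sol: "classical_solution s f u"
    and g_cont: "continuous_on halfspace (\<lambda>(t, x). f t x (u t x))"
    and u_L1: "in_L1_Ls s T u" and \<rho>: "0 < \<rho>"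
  shows "\<exists>M. \<forall>a b. 0 < a \<longrightarrow> a \<le> b \<longrightarrow> b < T \<longrightarrow>
    \<bar>(\<integral>x. bump z \<rho> x * u a x \<partial>lborel) - (\<integral>x. bump z \<rho> x * u b x \<partial>lborel)
      - integral {a..b} (\<lambda>t. \<integral>x. bump z \<rho> x * f t x (u t x) \<partial>lborel)\<bar> \<le> M"
proof -
  obtain ut \<Lambda> where
    ut: "continuous_on halfspace (\<lambda>(t, x). ut t x)" and \<Lambda>: "continuous_on halfspace (\<lambda>(t, x). \<Lambda> t x)"
    and eq: "\<And>t x. 0 < t \<Longrightarrow> ((\<lambda>\<tau>. u \<tau> x) has_real_derivative ut t x) (at t)"
      "\<And>t x. 0 < t \<Longrightarrow> has_frac_laplacian s (u t) x (\<Lambda> t x)"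
      "\<And>t x. 0 < t \<Longrightarrow> ut t x + \<Lambda> t x + f t x (u t x) = 0"
    using sol unfolding classical_solution_def by blast
  have u_cont: "continuous_on halfspace (\<lambda>(t, x). u t x)" and u_Ls: "\<And>t. 0 < t \<Longrightarrow> in_Ls s (u t)"
    using sol unfolding classical_solution_def by blast+
  define X where "X t = (\<integral>x. bump z \<rho> x * u t x \<partial>lborel)" for t
  define G where "G t = (\<integral>x. bump z \<rho> x * f t x (u t x) \<partial>lborel)" for t
  define A where "A t = (\<integral>x. bump z \<rho> x * \<Lambda> t x \<partial>lborel)" for t
  have G_cont: "continuous_on {0<..} G" unfolding G_def by (rule continuous_on_bump_integral[OF g_cont \<rho>])
  have A_cont: "continuous_on {0<..} A" unfolding A_def by (rule continuous_on_bump_integral[OF \<Lambda> \<rho>])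
  have deriv: "(X has_real_derivative - (A t + G t)) (at t)" if t: "0 < t" for t
  proof -
    have "(\<integral>x. bump z \<rho> x * ut t x \<partial>lborel) = (\<integral>x. - (bump z \<rho> x * \<Lambda> t x + bump z \<rho> x * f t x (u t x)) \<partial>lborel)"
    proof (rule Bochner_Integration.integral_cong[OF refl])
      fix x
      have e: "ut t x = - (\<Lambda> t x + f t x (u t x))" using eq(3)[OF t, of x] by linarith
      show "bump z \<rho> x * ut t x = - (bump z \<rho> x * \<Lambda> t x + bump z \<rho> x * f t x (u t x))"
        unfolding e by (simp add: algebra_simps)
    qed
    also have "\<dots> = - (A t + G t)"
      unfolding A_def G_def
      using integrable_bump_times_continuous[OF \<rho> continuous_on_halfspace_slice[OF \<Lambda> t], of z]
        integrable_bump_times_continuous[OF \<rho> continuous_on_halfspace_slice[OF g_cont t], of z] by simp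
    finally show ?thesis
      unfolding X_def using bump_integral_has_derivative[OF u_cont ut eq(1) \<rho> t, of z] by simp
  qed
  let ?p = "real CARD('n) + 2 * s"
  have p: "real DIM(real^'n) < ?p" "?p < real DIM(real^'n) + 2" using s by auto
  obtain K where K: "0 \<le> K"
    and K_bound: "\<And>\<phi> h. \<lbrakk>continuous_on UNIV \<phi>; integrable lborel (\<lambda>x. \<phi> x * decay ?p x); continuous_on UNIV h;
      \<forall>x. ((\<lambda>\<epsilon>. frac_const TYPE('n) s * trunc_lap ?p \<epsilon> \<phi> x) \<longlongrightarrow> h x) (at_right 0)\<rbrakk> \<Longrightarrow>
      \<bar>\<integral>x. bump z \<rho> x * h x \<partial>lborel\<bar> \<le> K * (\<integral>x. \<bar>\<phi> x\<bar> * decay ?p x \<partial>lborel)"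
    using bump_lap_bound[OF p \<rho> less_imp_le[OF frac_const_pos[OF s, where 'n = 'n]], of z] by blast
  \<comment> \<open>Dividing by K + 1 is safe when K = 0. The comparison is made in
    \<open>ennreal\<close>, so monotonicity of the nonnegative integral carries it to time
    integrals.\<close>
  have A_le: "ennreal (\<bar>A t\<bar> / (K + 1)) \<le> Ls_norm s (u t)" if t: "0 < t" for t
  proof -
    have c: "continuous_on UNIV (u t)" by (rule continuous_on_halfspace_slice[OF u_cont t])
    have m [measurable]: "u t \<in> borel_measurable borel" by (rule borel_measurable_continuous_onI[OF c])
    note i = in_Ls_integrable[OF m u_Ls[OF t]]
    let ?N = "\<integral>x. \<bar>u t x\<bar> * decay ?p x \<partial>lborel"
    have N: "0 \<le> ?N" by (intro integral_nonneg_AE AE_I2) (simp add: decay_pos less_imp_le)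
    have "\<bar>A t\<bar> \<le> K * ?N"
      unfolding A_def
      by (rule K_bound[OF c i(1) continuous_on_halfspace_slice[OF \<Lambda> t]])
         (use eq(2)[OF t] in \<open>simp add: has_frac_laplacian_iff_trunc_lap\<close>)
    then have "\<bar>A t\<bar> / (K + 1) \<le> ?N" using K N by (simp add: pos_divide_le_eq algebra_simps)
    then show ?thesis unfolding i(2) by (rule ennreal_leI)
  qed
  define Q where "Q = (\<integral>\<^sup>+ t\<in>{0<..<T}. Ls_norm s (u t) \<partial>lebesgue)"
  have Q: "Q < \<infinity>" using u_L1 unfolding Q_def in_L1_Ls_def by blast
  have "\<bar>X a - X b - integral {a..b} G\<bar> \<le> (K + 1) * enn2real Q" if ab: "0 < a" "a \<le> b" "b < T" for a b
  proof -
    have sub: "{a..b} \<subseteq> {0<..}" using ab by auto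
    have A_ab: "continuous_on {a..b} A" and G_ab: "continuous_on {a..b} G"
      by (rule continuous_on_subset[OF A_cont sub] continuous_on_subset[OF G_cont sub])+
    have "((\<lambda>t. - (A t + G t)) has_integral (X b - X a)) {a..b}"
    proof (rule fundamental_theorem_of_calculus[OF ab(2)])
      show "(X has_vector_derivative - (A t + G t)) (at t within {a..b})" if "t \<in> {a..b}" for t
        using that ab deriv[of t]
        by (auto simp: has_real_derivative_iff_has_vector_derivative[symmetric] intro: has_field_derivative_at_within)
    qed
    from integral_unique[OF has_integral_neg[OF this]]
    have "X a - X b = integral {a..b} (\<lambda>t. A t + G t)"
      by (simp add: add.commute)
    also have "\<dots> = integral {a..b} A + integral {a..b} G"
      by (intro Henstock_Kurzweil_Integration.integral_add integrable_continuous_interval A_ab G_ab)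
    finally have e: "X a - X b - integral {a..b} G = integral {a..b} A" by simp
    have abs_cont: "continuous_on {a..b} (\<lambda>t. \<bar>A t\<bar> / (K + 1))"
      using K by (intro continuous_intros A_ab) auto
    have "ennreal (integral {a..b} (\<lambda>t. \<bar>A t\<bar> / (K + 1))) = (\<integral>\<^sup>+ t\<in>{a..b}. ennreal (\<bar>A t\<bar> / (K + 1)) \<partial>lborel)"
      by (rule nn_integral_Icc[symmetric, OF abs_cont]) (use K in auto)
    also have "\<dots> \<le> (\<integral>\<^sup>+ t\<in>{0<..<T}. Ls_norm s (u t) \<partial>lborel)"
      using ab A_le by (intro nn_integral_mono) (auto simp: indicator_def)
    also have "\<dots> = ennreal (enn2real Q)"
      using Q unfolding Q_def nn_integral_completion by simp
    finally have "integral {a..b} (\<lambda>t. \<bar>A t\<bar> / (K + 1)) \<le> enn2real Q" by simp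
    then have "integral {a..b} (\<lambda>t. \<bar>A t\<bar>) \<le> (K + 1) * enn2real Q"
      using K by (simp add: field_simps)
    moreover have "\<bar>integral {a..b} A\<bar> \<le> integral {a..b} (\<lambda>t. \<bar>A t\<bar>)"
      using integral_norm_bound_integral[of A "{a..b}" "\<lambda>t. \<bar>A t\<bar>"] A_ab
      by (auto intro: integrable_continuous_interval continuous_intros)
    ultimately show ?thesis unfolding e by linarith
  qed
  then show ?thesis unfolding X_def G_def by blast
qed

section \<open>Behaviour of the mass at singular and at regular points\<close>

text \<open>The time integral of G diverges at 0, so by the balance X(a) \<ge> X(b) + (integral of G
  over [a,b]) - M tends to infinity, and the mass on the ball dominates X.\<close>

lemma mass_at_top_of_cond_singular:
  fixes s T :: real
    and f :: "real \<Rightarrow> real^'n \<Rightarrow> real \<Rightarrow> real"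
    and u :: "real \<Rightarrow> real^'n \<Rightarrow> real"
  assumes s: "0 < s" "s < 1"
    and f_sign: "\<And>t x r. t > 0 \<Longrightarrow> f t x r * r \<ge> 0"
    and u_solution: "classical_solution s f u"
    and u_nonneg: "\<And>t x. t > 0 \<Longrightarrow> u t x \<ge> 0"
    and T: "T > 0"
    and u_L1: "in_L1_Ls s T u"
    and z: "z \<in> cond_singular_set f u" and \<rho>: "0 < \<rho>"
  shows "filterlim (\<lambda>t. LINT x:ball z \<rho>|lebesgue. u t x) at_top (at_right 0)"
proof -
  define g where "g t x = f t x (u t x)" for t x
  have g_cont: "continuous_on halfspace (\<lambda>(t, x). g t x)"
    unfolding g_def by (rule classical_solution_reaction(1)[OF s f_sign u_solution u_nonneg])
  have g0: "0 \<le> g t x" if "0 < t" for t x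
    unfolding g_def by (rule classical_solution_reaction(2)[OF s f_sign u_solution u_nonneg that])
  have u_cont: "continuous_on halfspace (\<lambda>(t, x). u t x)"
    using u_solution unfolding classical_solution_def by blast
  note ut_cont = continuous_on_halfspace_slice[OF u_cont]
  note gt_cont = continuous_on_halfspace_slice[OF g_cont]
  define X where "X z \<rho> t = (\<integral>x. bump z \<rho> x * u t x \<partial>lborel)" for z \<rho> t
  define G where "G z \<rho> t = (\<integral>x. bump z \<rho> x * g t x \<partial>lborel)" for z \<rho> t
  define m where "m z \<rho> t = (LINT x:ball z \<rho>|lebesgue. u t x)" for z \<rho> t
  \<comment> \<open>The fixed later time lies below T for the balance and below 1, the end of the
    time interval in \<open>regular_set\<close>.\<close>
  define b where "b = min T 1 / 2"
  have b: "0 < b" "b < T" "b < 1" unfolding b_def using T by auto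
  have G_cont: "continuous_on {0<..} (G z \<rho>)" if "0 < \<rho>" for z \<rho>
    unfolding G_def by (rule continuous_on_bump_integral[OF g_cont that])
  have G0: "0 \<le> G z \<rho> t" if "0 < t" for z \<rho> t
    unfolding G_def by (intro integral_nonneg_AE AE_I2 mult_nonneg_nonneg bump_nonneg g0 that)
  have balance: "\<exists>M. \<forall>a. 0 < a \<longrightarrow> a \<le> b \<longrightarrow> \<bar>X z \<rho> a - X z \<rho> b - integral {a..b} (G z \<rho>)\<bar> \<le> M"
    if "0 < \<rho>" for z \<rho>
    using bump_mass_balance[OF s u_solution g_cont[unfolded g_def] u_L1 that, of z] b(2)
    unfolding X_def G_def g_def by blast
  have X_le: "X z \<rho> t \<le> m z \<rho> t" if "0 < \<rho>" "0 < t" for z \<rho> t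
    unfolding X_def m_def lebesgue_ball_integral[OF ut_cont[OF that(2)]]
    using that by (intro bump_integral_le_ball_integral ut_cont u_nonneg) auto
  have inner: "(\<integral>\<^sup>+ x\<in>ball z \<rho>. ennreal (f t x (u t x)) \<partial>lebesgue) = ennreal (\<integral>x. indicator (ball z \<rho>) x * g t x \<partial>lborel)"
    if "0 < t" for z \<rho> t
    using nn_integral_ball[OF gt_cont[OF that] g0[OF that]] unfolding g_def .
  have "(\<integral>\<^sup>+ t\<in>{0<..<1}. ennreal (G z \<rho> t) \<partial>lborel) = \<infinity>"
  proof -
    \<comment> \<open>Divergence is invoked at radius \<rho>/2 because twice the cutoff of radius
      \<rho> dominates the indicator of that smaller ball.\<close>
    have "\<not> (\<integral>\<^sup>+ t\<in>{0<..<1}. (\<integral>\<^sup>+ x\<in>ball z (\<rho> / 2). ennreal (f t x (u t x)) \<partial>lebesgue) \<partial>lebesgue) < \<infinity>"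
      using z half_gt_zero[OF \<rho>] unfolding cond_singular_set_def regular_set_def by blast
    then have "\<infinity> = (\<integral>\<^sup>+ t\<in>{0<..<1}. (\<integral>\<^sup>+ x\<in>ball z (\<rho> / 2). ennreal (f t x (u t x)) \<partial>lebesgue) \<partial>lebesgue)"
      by (simp add: not_less top_unique)
    also have "\<dots> \<le> (\<integral>\<^sup>+ t. 2 * (ennreal (G z \<rho> t) * indicator {0<..<1} t) \<partial>lborel)"
      unfolding nn_integral_completion[of lborel "\<lambda>t. _ t * indicator {0<..<1} t"]
    proof (intro nn_integral_mono)
      fix t :: real
      show "(\<integral>\<^sup>+ x\<in>ball z (\<rho> / 2). ennreal (f t x (u t x)) \<partial>lebesgue) * indicator {0<..<1} t
        \<le> 2 * (ennreal (G z \<rho> t) * indicator {0<..<1} t)"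
      proof (cases "t \<in> {0<..<1}")
        case True
        then have t: "0 < t" by simp
        have "ennreal (\<integral>x. indicator (ball z (\<rho> / 2)) x * g t x \<partial>lborel) \<le> ennreal (2 * G z \<rho> t)"
          unfolding G_def by (intro ennreal_leI ball_integral_le_bump_integral gt_cont g0 \<rho> t)
        then show ?thesis using True G0[OF t, of z \<rho>] by (simp add: inner[OF t] ennreal_mult)
      qed simp
    qed
    also have "\<dots> = 2 * (\<integral>\<^sup>+ t\<in>{0<..<1}. ennreal (G z \<rho> t) \<partial>lborel)"
    proof (rule nn_integral_cmult)
      \<comment> \<open>Nothing is known about G at t \<le> 0, so measurability is obtained for its
        restriction to positive times.\<close>
      have "(\<lambda>t. indicator {0<..} t *\<^sub>R G z \<rho> t) \<in> borel_measurable borel"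
        by (intro borel_measurable_continuous_on_indicator G_cont \<rho>) simp
      then have "(\<lambda>t. ennreal (indicator {0<..} t *\<^sub>R G z \<rho> t) * indicator {0<..<1} t) \<in> borel_measurable borel"
        by measurable
      also have "(\<lambda>t. ennreal (indicator {0<..} t *\<^sub>R G z \<rho> t) * indicator {0<..<1} t) = (\<lambda>t. ennreal (G z \<rho> t) * indicator {0<..<1} t)"
        by (auto simp: indicator_def)
      finally show "(\<lambda>t. ennreal (G z \<rho> t) * indicator {0<..<1} t) \<in> borel_measurable lborel" by simp
    qed
    finally show ?thesis by (auto simp: top_unique ennreal_mult_eq_top_iff)
  qed
  note G_unbounded = integral_unbounded_of_nn_integral_top[OF G_cont[OF \<rho>] G0 this b(1,3)]
  obtain M where M: "\<And>a. 0 < a \<Longrightarrow> a \<le> b \<Longrightarrow> \<bar>X z \<rho> a - X z \<rho> b - integral {a..b} (G z \<rho>)\<bar> \<le> M"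
    using balance[OF \<rho>, of z] by blast
  have "filterlim (m z \<rho>) at_top (at_right 0)"
    unfolding filterlim_at_top
  proof
    fix Z
    obtain a0 where a0: "0 < a0" "a0 < b"
      and a0_le: "\<And>a. 0 < a \<Longrightarrow> a \<le> a0 \<Longrightarrow> Z + M - X z \<rho> b \<le> integral {a..b} (G z \<rho>)"
      using G_unbounded[of "Z + M - X z \<rho> b"] by blast
    have "Z \<le> m z \<rho> a" if "0 < a" "a < a0" for a
      using X_le[OF \<rho> that(1), of z] M[OF that(1)] a0_le[OF that(1)] that(2) a0(2) by linarith
    then show "\<forall>\<^sub>F t in at_right 0. Z \<le> m z \<rho> t"
      unfolding eventually_at_right_field using a0(1) by blast
  qed
  then show ?thesis unfolding m_def .
qed

text \<open>If the reaction is integrable on the ball of radius \<rho>, then so is G, because the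
  cutoff is below the indicator of that ball. The balance bounds X near t = 0, hence the mass on the
  ball of radius \<rho>/2, and one radius with finite limsup excludes z.\<close>

lemma not_singular_of_regular:
  fixes s T :: real
    and f :: "real \<Rightarrow> real^'n \<Rightarrow> real \<Rightarrow> real"
    and u :: "real \<Rightarrow> real^'n \<Rightarrow> real"
  assumes s: "0 < s" "s < 1"
    and f_sign: "\<And>t x r. t > 0 \<Longrightarrow> f t x r * r \<ge> 0"
    and u_solution: "classical_solution s f u"
    and u_nonneg: "\<And>t x. t > 0 \<Longrightarrow> u t x \<ge> 0"
    and T: "T > 0"
    and u_L1: "in_L1_Ls s T u"
    and z: "z \<in> regular_set f u"
  shows "z \<notin> singular_set u"
proof -
  define g where "g t x = f t x (u t x)" for t x
  have g_cont: "continuous_on halfspace (\<lambda>(t, x). g t x)"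
    unfolding g_def by (rule classical_solution_reaction(1)[OF s f_sign u_solution u_nonneg])
  have g0: "0 \<le> g t x" if "0 < t" for t x
    unfolding g_def by (rule classical_solution_reaction(2)[OF s f_sign u_solution u_nonneg that])
  have u_cont: "continuous_on halfspace (\<lambda>(t, x). u t x)"
    using u_solution unfolding classical_solution_def by blast
  note ut_cont = continuous_on_halfspace_slice[OF u_cont]
  note gt_cont = continuous_on_halfspace_slice[OF g_cont]
  define X where "X z \<rho> t = (\<integral>x. bump z \<rho> x * u t x \<partial>lborel)" for z \<rho> t
  define G where "G z \<rho> t = (\<integral>x. bump z \<rho> x * g t x \<partial>lborel)" for z \<rho> t
  define m where "m z \<rho> t = (LINT x:ball z \<rho>|lebesgue. u t x)" for z \<rho> t
  define b where "b = min T 1 / 2"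
  have b: "0 < b" "b < T" "b < 1" unfolding b_def using T by auto
  have G_cont: "continuous_on {0<..} (G z \<rho>)" if "0 < \<rho>" for z \<rho>
    unfolding G_def by (rule continuous_on_bump_integral[OF g_cont that])
  have G0: "0 \<le> G z \<rho> t" if "0 < t" for z \<rho> t
    unfolding G_def by (intro integral_nonneg_AE AE_I2 mult_nonneg_nonneg bump_nonneg g0 that)
  have balance: "\<exists>M. \<forall>a. 0 < a \<longrightarrow> a \<le> b \<longrightarrow> \<bar>X z \<rho> a - X z \<rho> b - integral {a..b} (G z \<rho>)\<bar> \<le> M"
    if "0 < \<rho>" for z \<rho>
    using bump_mass_balance[OF s u_solution g_cont[unfolded g_def] u_L1 that, of z] b(2)
    unfolding X_def G_def g_def by blast
  have m_le: "m z (\<rho> / 2) t \<le> 2 * X z \<rho> t" if "0 < \<rho>" "0 < t" for z \<rho> t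
    unfolding X_def m_def lebesgue_ball_integral[OF ut_cont[OF that(2)]]
    using that by (intro ball_integral_le_bump_integral ut_cont u_nonneg) auto
  have inner: "(\<integral>\<^sup>+ x\<in>ball z \<rho>. ennreal (f t x (u t x)) \<partial>lebesgue) = ennreal (\<integral>x. indicator (ball z \<rho>) x * g t x \<partial>lborel)"
    if "0 < t" for z \<rho> t
    using nn_integral_ball[OF gt_cont[OF that] g0[OF that]] unfolding g_def .
  obtain \<rho> where \<rho>: "0 < \<rho>"
    and fin: "(\<integral>\<^sup>+ t\<in>{0<..<1}. (\<integral>\<^sup>+ x\<in>ball z \<rho>. ennreal (f t x (u t x)) \<partial>lebesgue) \<partial>lebesgue) < \<infinity>"
    using z unfolding regular_set_def by blast
  define P where "P = (\<integral>\<^sup>+ t\<in>{0<..<1}. (\<integral>\<^sup>+ x\<in>ball z \<rho>. ennreal (f t x (u t x)) \<partial>lebesgue) \<partial>lborel)"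
  have P: "P < \<infinity>" using fin unfolding P_def nn_integral_completion[of lborel "\<lambda>t. _ t * indicator {0<..<1} t"] .
  have G_le: "integral {a..b} (G z \<rho>) \<le> enn2real P" if a: "0 < a" for a
  proof -
    have "ennreal (integral {a..b} (G z \<rho>)) = (\<integral>\<^sup>+ t\<in>{a..b}. ennreal (G z \<rho> t) \<partial>lborel)"
      using a by (intro nn_integral_Icc[symmetric] continuous_on_subset[OF G_cont[OF \<rho>]] G0) auto
    also have "\<dots> \<le> P"
      unfolding P_def
    proof (intro nn_integral_mono)
      fix t
      show "ennreal (G z \<rho> t) * indicator {a..b} t
        \<le> (\<integral>\<^sup>+ x\<in>ball z \<rho>. ennreal (f t x (u t x)) \<partial>lebesgue) * indicator {0<..<1} t"
      proof (cases "t \<in> {a..b}")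
        case True
        then have t: "0 < t" "t < 1" using a b(3) by auto
        have "ennreal (G z \<rho> t) \<le> ennreal (\<integral>x. indicator (ball z \<rho>) x * g t x \<partial>lborel)"
          unfolding G_def by (intro ennreal_leI bump_integral_le_ball_integral gt_cont g0 \<rho> t)
        then show ?thesis using True t by (simp add: inner[OF t(1)])
      qed simp
    qed
    also have "\<dots> = ennreal (enn2real P)" using P by simp
    finally show ?thesis by simp
  qed
  obtain M where M: "\<And>a. 0 < a \<Longrightarrow> a \<le> b \<Longrightarrow> \<bar>X z \<rho> a - X z \<rho> b - integral {a..b} (G z \<rho>)\<bar> \<le> M"
    using balance[OF \<rho>, of z] by blast
  let ?B = "2 * (X z \<rho> b + M + enn2real P)"
  have "m z (\<rho> / 2) a \<le> ?B" if "0 < a" "a < b" for a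
  proof -
    have "X z \<rho> a - X z \<rho> b - integral {a..b} (G z \<rho>) \<le> M"
      by (rule abs_le_D1[OF M[OF that(1) less_imp_le[OF that(2)]]])
    then have "X z \<rho> a \<le> X z \<rho> b + M + enn2real P" using G_le[OF that(1)] by linarith
    then have "2 * X z \<rho> a \<le> ?B" by simp
    with m_le[OF \<rho> that(1)] show ?thesis by (rule order.trans)
  qed
  then have "\<forall>\<^sub>F t in at_right 0. ereal (m z (\<rho> / 2) t) \<le> ereal ?B"
    unfolding eventually_at_right_field using b(1) by auto
  then have "Limsup (at_right 0) (\<lambda>t. ereal (m z (\<rho> / 2) t)) \<le> ereal ?B" by (rule Limsup_bounded)
  then have "Limsup (at_right 0) (\<lambda>t. ereal (m z (\<rho> / 2) t)) \<noteq> \<infinity>" by auto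
  then show ?thesis using \<rho> unfolding singular_set_def m_def by force
qed

theorem theoremB:
  fixes s T :: real
    and f :: "real \<Rightarrow> real^'n \<Rightarrow> real \<Rightarrow> real"
    and u :: "real \<Rightarrow> real^'n \<Rightarrow> real"
  assumes s: "0 < s" "s < 1"
    and f_caratheodory: "caratheodory f"
    and f_sign: "\<And>t x r. t > 0 \<Longrightarrow> f t x r * r \<ge> 0"
    and u_solution: "classical_solution s f u"
    and u_nonneg: "\<And>t x. t > 0 \<Longrightarrow> u t x \<ge> 0"
    and T: "T > 0"
    and u_L1: "in_L1_Ls s T u"
  shows "singular_set u = cond_singular_set f u \<and>
    (\<forall>z\<in>singular_set u. \<forall>\<rho>>0.
       filterlim (\<lambda>t. LINT x:ball z \<rho>|lebesgue. u t x) at_top (at_right 0))"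
proof -
  have sing: "filterlim (\<lambda>t. LINT x:ball z \<rho>|lebesgue. u t x) at_top (at_right 0)"
    if "z \<in> cond_singular_set f u" "0 < \<rho>" for z \<rho>
    by (rule mass_at_top_of_cond_singular[OF s f_sign u_solution u_nonneg T u_L1 that])
  have reg: "z \<notin> singular_set u" if "z \<in> regular_set f u" for z
    by (rule not_singular_of_regular[OF s f_sign u_solution u_nonneg T u_L1 that])
  \<comment> \<open>A limit along the nontrivial filter \<open>at_right 0\<close> is also the
    limsup. The opposite inclusion is the contrapositive of \<open>reg\<close>, and equality of the
    sets carries the full limit over to \<open>singular_set u\<close>.\<close>
  have "z \<in> singular_set u" if z: "z \<in> cond_singular_set f u" for z
    unfolding singular_set_def
  proof (intro CollectI allI impI)
    fix \<rho> :: real assume "0 < \<rho>"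
    then have "((\<lambda>t. ereal (LINT x:ball z \<rho>|lebesgue. u t x)) \<longlongrightarrow> \<infinity>) (at_right 0)"
      using sing[OF z] by (simp add: tendsto_PInfty_eq_at_top)
    then show "Limsup (at_right 0) (\<lambda>t. ereal (LINT x:ball z \<rho>|lebesgue. u t x)) = \<infinity>"
      by (rule lim_imp_Limsup[rotated]) simp
  qed
  then have "singular_set u = cond_singular_set f u"
    using reg unfolding cond_singular_set_def by blast
  then show ?thesis using sing by blast
qed

end
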